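(* Let $f$ be a continuous, nondecreasing, piecewise linear function with breakpoints $\gamma_1<\dots<\gamma_M$ and slopes $\mu_0=0,\mu_1,\dots,\mu_M$ as described in the context, and let $f(x+t)$ be regarded as a function of $x$ parameterized by $t\in\mathbb{R}$. Let $x_1<x_2$, $\nu>0$, and let $g$ be the noncontinuous function $g(x)=-\nu(x-x_2)$ for $x\in[x_1,x_2)$ and $g(x)=0$ for $x\notin[x_1,x_2)$. Let $A=\{a_1<\dots<a_{|A|}\}$ and $B=\{b_1<\dots<b_{|B|}\}$ be the index sets defined in the context. If $|B|\ge 1$, let $\Omega=\{\omega_1,\dots,\omega_{|B|}\}$, where each $\omega_j$, finite or equal to $+\infty$, is the value produced by the algorithm in the context (run once for each $j=1,\dots,|B|$), and let $T=\{t^\star_1,\dots,t^\star_Q\}$ be obtained from $\Omega$ by removing all nonfinite values, that is, $T=\Omega\setminus\{\omega_j:\omega_j=+\infty,\ j=1,\dots,|B|\}$ (the remaining values being kept in order of increasing index $j$); $Q$ is the cardinality of $T$, and $1\le Q\le|B|$. If $|B|=0$, let $T=\emptyset$ and $Q=0$. For $q=1,\dots,Q$ let $l(q)\in\{1,\dots,|B|\}$ be the index of the value $t^\star_q$ in $\Omega$, that is, $l(q)=j\Leftrightarrow\omega_j=t^\star_q$. Set $l(0)=0$, and $t^\star_Q=-\infty$ when $Q=0$. It is always $l(Q)=|B|$ and, in case $|A|>|B|$, $l(Q)+1=|A|$. Then the function of $t$ $$x^\circ(t)=\arg\min_{x_1\le x\le x_2}\{f(x+t)+g(x)\}$$ is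 a nonincreasing, possibly noncontinuous, piecewise linear function of $t$ defined as follows: - if $Q=0$: $x^\circ(t)=x_{\mathrm e}(t)$; - if $Q=1$: $x^\circ(t)=x_{\mathrm s}(t)$ for $t<t^\star_1$ and $x^\circ(t)=x_{\mathrm e}(t)$ for $t\ge t^\star_1$; - if $Q>1$: $x^\circ(t)=x_{\mathrm s}(t)$ for $t<t^\star_1$; $x^\circ(t)=x_q(t)$ for $t^\star_q\le t<t^\star_{q+1}$, $q=1,\dots,Q-1$; $x^\circ(t)=x_{\mathrm e}(t)$ for $t\ge t^\star_Q$; where $x_{\mathrm s},x_q,x_{\mathrm e}$ are the following continuous nonincreasing piecewise linear functions of $t$. (s) If $t^\star_1>\gamma_{a_1}-x_1$: $$x_{\mathrm s}(t)=\begin{cases}x_2 & t<\gamma_{a_1}-x_2\\ -t+\gamma_{a_1} & \gamma_{a_1}-x_2\le t<\gamma_{a_1}-x_1\\ x_1 & \gamma_{a_1}-x_1\le t<t^\star_1;\end{cases}$$ if $t^\star_1\le\gamma_{a_1}-x_1$: $$x_{\mathrm s}(t)=\begin{cases}x_2 & t<\gamma_{a_1}-x_2\\ -t+\gamma_{a_1} & \gamma_{a_1}-x_2\le t<t^\star_1.\end{cases}$$ (q) For $q=1,\dots,Q-1$, writing $\Gamma_q=\gamma_{a_{l(q)+1}}$: if $t^\star_q<\Gamma_q-x_2$ and $t^\star_{q+1}>\Gamma_q-x_1$: $$x_q(t)=\begin{cases}x_2 & t^\star_q\le t<\Gamma_q-x_2\\ -t+\Gamma_q & \Gamma_q-x_2\le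 t<\Gamma_q-x_1\\ x_1 & \Gamma_q-x_1\le t<t^\star_{q+1};\end{cases}$$ if $t^\star_q\ge\Gamma_q-x_2$ and $t^\star_{q+1}>\Gamma_q-x_1$: $$x_q(t)=\begin{cases}-t+\Gamma_q & t^\star_q\le t<\Gamma_q-x_1\\ x_1 & \Gamma_q-x_1\le t<t^\star_{q+1};\end{cases}$$ if $t^\star_q<\Gamma_q-x_2$ and $t^\star_{q+1}\le\Gamma_q-x_1$: $$x_q(t)=\begin{cases}x_2 & t^\star_q\le t<\Gamma_q-x_2\\ -t+\Gamma_q & \Gamma_q-x_2\le t<t^\star_{q+1};\end{cases}$$ if $t^\star_q\ge\Gamma_q-x_2$ and $t^\star_{q+1}\le\Gamma_q-x_1$: $x_q(t)=-t+\Gamma_q$. (e) If $l(Q)<|A|$, writing $\Gamma_Q=\gamma_{a_{l(Q)+1}}$: if $t^\star_Q<\Gamma_Q-x_2$, $$x_{\mathrm e}(t)=\begin{cases}x_2 & t^\star_Q\le t<\Gamma_Q-x_2\\ -t+\Gamma_Q & \Gamma_Q-x_2\le t<\Gamma_Q-x_1\\ x_1 & t\ge\Gamma_Q-x_1;\end{cases}$$ if $t^\star_Q\ge\Gamma_Q-x_2$, $$x_{\mathrm e}(t)=\begin{cases}-t+\Gamma_Q & t^\star_Q\le t<\Gamma_Q-x_1\\ x_1 & t\ge\Gamma_Q-x_1.\end{cases}$$ If $l(Q)=|A|$: $x_{\mathrm e}(t)=x_2$.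
   Context: **The function $f$.** $f:\mathbb{R}\to\mathbb{R}$ is continuous, nondecreasing and piecewise linear with $M\ge1$ changes of slope, at abscissae $\gamma_1<\gamma_2<\dots<\gamma_M$. Its slope is $\mu_0$ on $(-\infty,\gamma_1)$, $\mu_i$ on $[\gamma_i,\gamma_{i+1})$ for $i=1,\dots,M-1$, and $\mu_M$ on $[\gamma_M,+\infty)$, with $\mu_{i+1}\ne\mu_i$ for $i=0,\dots,M-1$. Moreover $f(x)=0$ for all $x\le\gamma_1$, so $\mu_0=0$. **The sets $A$, $B$.** $A$ is the set of $i\in\{1,\dots,M\}$ with $\mu_{i-1}<\nu$ and $\mu_i\ge\nu$; its elements in increasing order are $a_1,\dots,a_{|A|}$. $B$ is the set of $i\in\{1,\dots,M\}$ with $\mu_{i-1}\ge\nu$ and $\mu_i<\nu$; its elements in increasing order are $b_1,\dots,b_{|B|}$. Since $\mu_0=0$: $a_j<b_j$ for $j=1,\dots,|B|$, $b_j<a_{j+1}$ for $j=1,\dots,|A|-1$, and $|A|=|B|$ if $\mu_M<\nu$, $|A|=|B|+1$ if $\mu_M\ge\nu$. **Algorithm (for a given $j\in\{1,\dots,|B|\}$, determines the time instant $\omega_j$ at which, in case $\omega_j<+\infty$, the function $x^\circ(t)$ jumps in an upward direction).** Variables are updated by assignment ($:=$). *Section A (initialization).* Put $\gamma_0:=-\infty$; let $h\ge0$ be such that $\gamma_h\le\gamma_{b_j}-(x_2-x_1)<\gamma_{h+1}$; $i:=b_j$; $\gamma_{M+1}:=+\infty$; let $k\le M$ be such that $\gamma_k<\gamma_{b_j}+(x_2-x_1)\le\gamma_{k+1}$.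 If $j=|B|$ and $|A|=|B|$, put $a_{j+1}:=M+1$. For $p=h,\dots,k$ put $\tilde\mu_p:=\mu_p-\nu$. Put $\tau:=\gamma_{b_j}-(x_2-x_1)$, $\theta:=\gamma_{b_j}$, $d:=\max\{0,\tilde\mu_h(\gamma_{h+1}-\tau)\}$. If $h<b_j-1$, then for $p=h+1,\dots,b_j-1$ (in order) $d:=\max\{0,d+\tilde\mu_p(\gamma_{p+1}-\gamma_p)\}$. Put $\lambda:=h$, $\xi:=i$. *Section B (first loop).* While $h<b_j$ and $i<a_{j+1}$ do: 1. $\psi:=\min\{\gamma_{h+1}-\tau,\ \gamma_{i+1}-\theta\}$. 2. If $\gamma_{h+1}-\tau\le\gamma_{i+1}-\theta$, put $\lambda:=h+1$. If $\gamma_{h+1}-\tau\ge\gamma_{i+1}-\theta$, put $\xi:=i+1$. 3. $\delta:=\max\{0,\tilde\mu_\lambda[\gamma_{\lambda+1}-(\tau+\psi)]\}$. If $\lambda<b_j-1$, then for $p=\lambda+1,\dots,b_j-1$ (in order) $\delta:=\max\{0,\delta+\tilde\mu_p(\gamma_{p+1}-\gamma_p)\}$. 4. If $\xi=b_j$: $\delta:=\delta+\tilde\mu_\xi[(\theta+\psi)-\gamma_\xi]$. Else if $\xi=a_{j+1}$: $\delta:=\delta+\sum_{p=b_j}^{\xi-1}\tilde\mu_p(\gamma_{p+1}-\gamma_p)$. Else: $\delta:=\delta+\sum_{p=b_j}^{\xi-1}\tilde\mu_p(\gamma_{p+1}-\gamma_p)+\tilde\mu_\xi[(\theta+\psi)-\gamma_\xi]$.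 5. If $\delta\le0$: put $a_0:=0$ and let $r\ge1$ be such that $a_{r-1}\le h<a_r$. - If $r\le j$: for each $q=r,\dots,j$ let $\chi_q:=\tilde\mu_h(\gamma_{h+1}-\tau)$, plus $\sum_{p=h+1}^{a_q-1}\tilde\mu_p(\gamma_{p+1}-\gamma_p)$ if $h<a_q-1$; let $m:=\min_{r\le q\le j}\chi_q$. If $m\le0$, output $\omega_j:=\tau-x_1-\frac{d}{\tilde\mu_i}$ and stop. Else if $-\frac{d-m}{\tilde\mu_i}\le\frac{m}{\tilde\mu_h}$, output $\omega_j:=\tau-x_1+\frac{d}{\tilde\mu_h-\tilde\mu_i}$ and stop. Else output $\omega_j:=\tau-x_1-\frac{d-m}{\tilde\mu_i}$ and stop. - If $r>j$: output $\omega_j:=\tau-x_1+\frac{d}{\tilde\mu_h-\tilde\mu_i}$ and stop. 6. If $\delta>0$: $h:=\lambda$, $i:=\xi$, $\tau:=\tau+\psi$, $\theta:=\theta+\psi$, $d:=\delta$. *Section C (second loop, entered if Section B ends without output).* While $h<b_j$ do: 1. $\psi:=\gamma_{h+1}-\tau$; $\lambda:=h+1$. 2. If $\lambda<b_j$: $\delta:=\max\{0,\tilde\mu_\lambda[\gamma_{\lambda+1}-(\tau+\psi)]\}$ and, if $\lambda<b_j-1$, for $p=\lambda+1,\dots,b_j-1$ (in order) $\delta:=\max\{0,\delta+\tilde\mu_p(\gamma_{p+1}-\gamma_p)\}$. Otherwise $\delta:=0$. 3. $\delta:=\delta+\sum_{p=b_j}^{a_{j+1}-1}\tilde\mu_p(\gamma_{p+1}-\gamma_p)$.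 4. If $\delta\le0$: put $\tau:=\tau+\frac{d}{\tilde\mu_h}$, $\theta:=\tau+(x_2-x_1)$; let $k\le M$ be such that $\gamma_k<\theta\le\gamma_{k+1}$; put $r:=a_{j+1}$, $\phi:=0$. While $r\le k$: put $\phi:=\phi+\tilde\mu_r(\gamma_{r+1}-\gamma_r)$ if $r<k$, and $\phi:=\phi+\tilde\mu_r(\theta-\gamma_r)$ otherwise; if $\phi<0$, output $\omega_j:=+\infty$ and stop; otherwise $r:=r+1$. If this inner loop ends without output, output $\omega_j:=\tau-x_1$ and stop. 5. If $\delta>0$: $h:=\lambda$, $\tau:=\tau+\psi$, $d:=\delta$.
   Formalization: "Nonincreasing" for x°(t) is false at the upward jumps and is claimed only between jump instants t*_q; T is a family indexed by j, so equal finite ω_j are all kept; m/μ̃_h with μ̃_h=0 is read as +∞; when the argmin is not unique, x°(t) is one of the minimizers. *)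

theory Defs
  imports "HOL-Analysis.Analysis"
begin

definition piecewise_linear_on :: "real set \<Rightarrow> (real \<Rightarrow> real) \<Rightarrow> bool" where
  "piecewise_linear_on S F \<longleftrightarrow>
     (\<exists>P. finite P \<and>
        (\<forall>I. is_interval I \<and> I \<subseteq> S - P \<longrightarrow> (\<exists>m c. \<forall>t\<in>I. F t = m * t + c)))"

text \<open>The locale has no assumptions: it only abbreviates the parameter list. The arguments of
  \<open>\<gamma>\<close> run over \<open>1..M\<close>, those of \<open>\<mu>\<close> over \<open>0..M\<close>.\<close>

locale pl_window =
  fixes M :: nat and \<gamma> \<mu> :: "nat \<Rightarrow> real" and \<nu> x\<^sub>1 x\<^sub>2 :: real
begin

definition gam :: "nat \<Rightarrow> ereal" where
  "gam p = (if p = 0 then - \<infinity> else if p \<le> M then ereal (\<gamma> p) else \<infinity>)"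

definition setA :: "nat set" where
  "setA = {i \<in> {1..M}. \<mu> (i - 1) < \<nu> \<and> \<mu> i \<ge> \<nu>}"

definition setB :: "nat set" where
  "setB = {i \<in> {1..M}. \<mu> (i - 1) \<ge> \<nu> \<and> \<mu> i < \<nu>}"

text \<open>Increasing enumerations with indices starting at 1.\<close>

definition a :: "nat \<Rightarrow> nat" where
  "a j = sorted_list_of_set setA ! (j - 1)"

definition b :: "nat \<Rightarrow> nat" where
  "b j = sorted_list_of_set setB ! (j - 1)"

text \<open>The algorithm's own version of the sequence \<open>a\<close> in run \<open>j\<close>, with its conventions for
  \<open>a\<^sub>0\<close> and for \<open>a_{j+1}\<close> when \<open>A\<close> has no such element.\<close>

definition aa :: "nat \<Rightarrow> nat \<Rightarrow> nat" where
  "aa j p = (if p = 0 then 0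
             else if p = j + 1 \<and> j = card setB \<and> card setA = card setB then M + 1
             else a p)"

definition mt :: "nat \<Rightarrow> real" where
  "mt p = \<mu> p - \<nu>"

text \<open>Net increment over the \<open>p\<close>-th segment. It is only meaningful for \<open>1 \<le> p < M\<close>; the runs
  never evaluate it elsewhere, since \<open>\<xi> = M + 1\<close> cannot occur.\<close>

definition seg :: "nat \<Rightarrow> real" where
  "seg p = mt p * (\<gamma> (p + 1) - \<gamma> p)"

text \<open>The iterated positive part starting at abscissa \<open>s\<close> in segment \<open>l\<close>, as used for \<open>d\<close> and
  \<open>\<delta>\<close>. The infinite value of \<open>gam (l + 1)\<close> matters only if \<open>l = b j = M\<close>; then \<open>mt l < 0\<close> and
  the maximum is 0.\<close>

definition pos_part_iter :: "nat \<Rightarrow> nat \<Rightarrow> real \<Rightarrow> real" where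
  "pos_part_iter j l s =
     fold (\<lambda>p d. max 0 (d + seg p)) [l + 1..<b j]
       (real_of_ereal (max 0 (ereal (mt l) * (gam (l + 1) - ereal s))))"

text \<open>Inner loop: \<open>True\<close> iff \<open>\<phi>\<close> becomes negative.\<close>

function phi_neg :: "nat \<Rightarrow> real \<Rightarrow> nat \<Rightarrow> real \<Rightarrow> bool" where
  "phi_neg k \<theta> r \<phi> =
     (if r \<le> k then
        let \<phi>' = \<phi> + (if r < k then seg r else mt r * (\<theta> - \<gamma> r))
        in if \<phi>' < 0 then True else phi_neg k \<theta> (r + 1) \<phi>'
      else False)"
  by pat_completeness auto
termination by (relation "Wellfounded.measure (\<lambda>(k, \<theta>, r, \<phi>). Suc k - r)") auto

declare phi_neg.simps [simp del]

definition outputC :: "nat \<Rightarrow> real \<Rightarrow> ereal" where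
  "outputC j \<tau> =
     (let \<theta> = \<tau> + (x\<^sub>2 - x\<^sub>1);
          k = (THE k. k \<le> M \<and> gam k < ereal \<theta> \<and> ereal \<theta> \<le> gam (k + 1))
      in if phi_neg k \<theta> (aa j (j + 1)) 0 then \<infinity> else ereal (\<tau> - x\<^sub>1))"

text \<open>\<open>None\<close>: the loop ends without output.\<close>

function sectionC :: "nat \<Rightarrow> nat \<Rightarrow> real \<Rightarrow> real \<Rightarrow> ereal option" where
  "sectionC j h \<tau> d =
     (if h < b j then
        let \<psi> = \<gamma> (h + 1) - \<tau>;
            l = h + 1;
            \<delta> = (if l < b j then pos_part_iter j l (\<tau> + \<psi>) else 0)
                + (\<Sum>p = b j..<aa j (j + 1). seg p)
        in if \<delta> \<le> 0 then Some (outputC j (\<tau> + d / mt h))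
           else sectionC j l (\<tau> + \<psi>) \<delta>
      else None)"
  by pat_completeness auto
termination by (relation "Wellfounded.measure (\<lambda>(j, h, \<tau>, d). b j - h)") auto

declare sectionC.simps [simp del]

text \<open>The comparison with \<open>m / mt h\<close> is made in \<^typ>\<open>ereal\<close>, because \<open>mt h = 0\<close> is possible;
  there \<open>m > 0\<close>, so the quotient is then \<open>\<infinity>\<close>, while it would be 0 in \<^typ>\<open>real\<close>.\<close>

definition outputB :: "nat \<Rightarrow> nat \<Rightarrow> nat \<Rightarrow> real \<Rightarrow> real \<Rightarrow> real" where
  "outputB j h i \<tau> d =
     (let r = (THE r. 1 \<le> r \<and> r \<le> j + 1 \<and> aa j (r - 1) \<le> h \<and> h < aa j r)
      in if r \<le> j then
           let chi = (\<lambda>q. mt h * (\<gamma> (h + 1) - \<tau>) + (\<Sum>p = h + 1..<aa j q. seg p));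
               m = Min (chi ` {r..j})
           in if m \<le> 0 then \<tau> - x\<^sub>1 - d / mt i
              else if ereal (- ((d - m) / mt i)) \<le> ereal m / ereal (mt h)
                then \<tau> - x\<^sub>1 + d / (mt h - mt i)
              else \<tau> - x\<^sub>1 - (d - m) / mt i
         else \<tau> - x\<^sub>1 + d / (mt h - mt i))"

function sectionB :: "nat \<Rightarrow> nat \<Rightarrow> nat \<Rightarrow> real \<Rightarrow> real \<Rightarrow> real \<Rightarrow> ereal option" where
  "sectionB j h i \<tau> \<theta> d =
     (if h < b j \<and> i < aa j (j + 1) then
        let u = gam (h + 1) - ereal \<tau>;
            v = gam (i + 1) - ereal \<theta>;
            \<psi> = real_of_ereal (min u v);
            l = (if u \<le> v then h + 1 else h);
            \<xi> = (if u \<ge> v then i + 1 else i);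
            \<delta> = pos_part_iter j l (\<tau> + \<psi>)
                + (if \<xi> = b j then mt \<xi> * ((\<theta> + \<psi>) - \<gamma> \<xi>)
                   else if \<xi> = aa j (j + 1) then (\<Sum>p = b j..<\<xi>. seg p)
                   else (\<Sum>p = b j..<\<xi>. seg p) + mt \<xi> * ((\<theta> + \<psi>) - \<gamma> \<xi>))
        in if \<delta> \<le> 0 then Some (ereal (outputB j h i \<tau> d))
           else sectionB j l \<xi> (\<tau> + \<psi>) (\<theta> + \<psi>) \<delta>
      else sectionC j h \<tau> d)"
  by pat_completeness auto
termination
  by (relation "Wellfounded.measure (\<lambda>(j, h, i, \<tau>, \<theta>, d). (b j - h) + (aa j (j + 1) - i))")
    (auto split: if_splits)

declare sectionB.simps [simp del]

definition \<omega> :: "nat \<Rightarrow> ereal" where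
  "\<omega> j =
     (let \<tau> = \<gamma> (b j) - (x\<^sub>2 - x\<^sub>1);
          h = (THE h. h \<le> M \<and> gam h \<le> ereal \<tau> \<and> ereal \<tau> < gam (h + 1))
      in the (sectionB j h (b j) \<tau> (\<gamma> (b j)) (pos_part_iter j h \<tau>)))"

text \<open>\<open>T\<close> is treated as a family in order of increasing index: two finite values \<open>\<omega> j\<close> can
  coincide, and then both are kept (the piece between them has empty domain).\<close>

definition finite_idx :: "nat set" where
  "finite_idx = {j \<in> {1..card setB}. \<omega> j \<noteq> \<infinity>}"

definition Q :: nat where
  "Q = card finite_idx"

definition l :: "nat \<Rightarrow> nat" where
  "l q = (if q = 0 then 0 else sorted_list_of_set finite_idx ! (q - 1))"

definition tstar :: "nat \<Rightarrow> ereal" where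
  "tstar q = (if q = 0 then - \<infinity> else \<omega> (l q))"

definition dom_s :: "real set" where
  "dom_s = {t. ereal t < tstar 1}"

definition dom_q :: "nat \<Rightarrow> real set" where
  "dom_q q = {t. tstar q \<le> ereal t \<and> ereal t < tstar (q + 1)}"

definition dom_e :: "real set" where
  "dom_e = {t. tstar Q \<le> ereal t}"

definition \<Gamma> :: "nat \<Rightarrow> real" where
  "\<Gamma> q = \<gamma> (a (l q + 1))"

text \<open>With \<open>Q = 0\<close>, \<open>dom_e\<close> is the whole line because \<open>tstar 0 = - \<infinity>\<close>. The functions \<open>x_s\<close>, \<open>x_q\<close>, \<open>x_e\<close> are meant on \<open>dom_s\<close>, \<open>dom_q q\<close>, \<open>dom_e\<close> only.\<close>

definition x_s :: "real \<Rightarrow> real" where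
  "x_s t =
     (if tstar 1 > ereal (\<gamma> (a 1) - x\<^sub>1) then
        (if t < \<gamma> (a 1) - x\<^sub>2 then x\<^sub>2
         else if t < \<gamma> (a 1) - x\<^sub>1 then - t + \<gamma> (a 1)
         else x\<^sub>1)
      else
        (if t < \<gamma> (a 1) - x\<^sub>2 then x\<^sub>2 else - t + \<gamma> (a 1)))"

definition x_q :: "nat \<Rightarrow> real \<Rightarrow> real" where
  "x_q q t =
     (if tstar q < ereal (\<Gamma> q - x\<^sub>2) \<and> tstar (q + 1) > ereal (\<Gamma> q - x\<^sub>1) then
        (if t < \<Gamma> q - x\<^sub>2 then x\<^sub>2
         else if t < \<Gamma> q - x\<^sub>1 then - t + \<Gamma> q
         else x\<^sub>1)
      else if tstar q \<ge> ereal (\<Gamma> q - x\<^sub>2) \<and> tstar (q + 1) > ereal (\<Gamma> q - x\<^sub>1) then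
        (if t < \<Gamma> q - x\<^sub>1 then - t + \<Gamma> q else x\<^sub>1)
      else if tstar q < ereal (\<Gamma> q - x\<^sub>2) \<and> tstar (q + 1) \<le> ereal (\<Gamma> q - x\<^sub>1) then
        (if t < \<Gamma> q - x\<^sub>2 then x\<^sub>2 else - t + \<Gamma> q)
      else - t + \<Gamma> q)"

definition x_e :: "real \<Rightarrow> real" where
  "x_e t =
     (if l Q < card setA then
        (if tstar Q < ereal (\<Gamma> Q - x\<^sub>2) then
           (if t < \<Gamma> Q - x\<^sub>2 then x\<^sub>2
            else if t < \<Gamma> Q - x\<^sub>1 then - t + \<Gamma> Q
            else x\<^sub>1)
         else
           (if t < \<Gamma> Q - x\<^sub>1 then - t + \<Gamma> Q else x\<^sub>1))
      else x\<^sub>2)"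

definition composed_of_pieces :: "(real \<Rightarrow> real) \<Rightarrow> bool" where
  "composed_of_pieces x \<longleftrightarrow>
     (Q = 0 \<longrightarrow> (\<forall>t. x t = x_e t)) \<and>
     (Q = 1 \<longrightarrow> (\<forall>t\<in>dom_s. x t = x_s t) \<and> (\<forall>t\<in>dom_e. x t = x_e t)) \<and>
     (Q > 1 \<longrightarrow> (\<forall>t\<in>dom_s. x t = x_s t)
               \<and> (\<forall>q\<in>{1..Q - 1}. \<forall>t\<in>dom_q q. x t = x_q q t)
               \<and> (\<forall>t\<in>dom_e. x t = x_e t))"

definition regular_piece :: "real set \<Rightarrow> (real \<Rightarrow> real) \<Rightarrow> bool" where
  "regular_piece S F \<longleftrightarrow>
     continuous_on S F \<and> antimono_on S F \<and> piecewise_linear_on S F"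

end

end

theory Submission
  imports Defs
begin

text \<open>On the window \<open>[x\<^sub>1, x\<^sub>2]\<close> the objective equals \<open>F (x + t)\<close> up to a constant, where
  \<open>F z = f z - \<nu> z\<close>, so the problem is to minimise \<open>F\<close> over the sliding window \<open>[s, s + len]\<close> with
  \<open>s = t + x\<^sub>1\<close>. \<open>F\<close> decreases strictly up to \<open>\<gamma> (a 1)\<close>, then is nondecreasing up to \<open>\<gamma> (b 1)\<close>,
  and so on alternately. Let \<open>D k s\<close> be the value of \<open>F\<close> at \<open>min (s + len) (\<gamma> (a (k + 1)))\<close> minus the
  minimum of \<open>F\<close> on \<open>[s, \<gamma> (b k)]\<close>; it is nonincreasing in \<open>s\<close>. Run \<open>k\<close> of the algorithm computes
  the first \<open>s\<close> with \<open>D k s \<le> 0\<close>, and returns \<open>\<infinity>\<close> exactly when at that moment the window contains,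
  to the right of \<open>\<gamma> (a (k + 1))\<close>, a point with a smaller value of \<open>F\<close>.
  If \<open>k\<close> is the last run with a finite output that has occurred by time \<open>t\<close>, the point of the window
  nearest to \<open>\<gamma> (a (k + 1))\<close> is a minimiser: it cannot be beaten from the left because \<open>D k s \<le> 0\<close>,
  and a better point on the right would be the tracked point of a later jump that already occurred.\<close>

section \<open>Local extrema of \<open>F\<close>\<close>

text \<open>If the \<open>j\<close>-th entry is at most \<open>p\<close>, so are the
  \<open>j\<close> entries up to it; if it exceeds \<open>p\<close>, the elements at most
  \<open>p\<close> stand among the first \<open>j - 1\<close>. This replaces list positions by
  counting.\<close>

lemma sorted_list_of_set_nth_le_iff:
  fixes S :: "'b::linorder set"
  assumes "finite S" "1 \<le> j" "j \<le> card S"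
  shows "sorted_list_of_set S ! (j - 1) \<le> p \<longleftrightarrow> j \<le> card {i \<in> S. i \<le> p}"
proof -
  define xs where "xs = sorted_list_of_set S"
  have xs: "set xs = S" "sorted xs" "distinct xs" "length xs = card S"
    using assms(1) by (auto simp: xs_def)
  show ?thesis unfolding xs_def[symmetric]
  proof
    assume le: "xs ! (j - 1) \<le> p"
    have "set (take j xs) \<subseteq> {i \<in> S. i \<le> p}"
    proof
      fix x assume "x \<in> set (take j xs)"
      then obtain n where n: "n < j" "n < length xs" "x = xs ! n"
        by (auto simp: in_set_conv_nth)
      moreover have "xs ! n \<le> xs ! (j - 1)"
        using n assms xs by (intro sorted_nth_mono) auto
      ultimately show "x \<in> {i \<in> S. i \<le> p}" using le xs(1) by (metis (mono_tags, lifting) mem_Collect_eq nth_mem order_trans)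
    qed
    then have "card (set (take j xs)) \<le> card {i \<in> S. i \<le> p}"
      using assms(1) by (intro card_mono) auto
    moreover have "card (set (take j xs)) = j"
      using xs assms by (simp add: distinct_card)
    ultimately show "j \<le> card {i \<in> S. i \<le> p}" by simp
  next
    assume le: "j \<le> card {i \<in> S. i \<le> p}"
    show "xs ! (j - 1) \<le> p"
    proof (rule ccontr)
      assume nle: "\<not> xs ! (j - 1) \<le> p"
      have "{i \<in> S. i \<le> p} \<subseteq> set (take (j - 1) xs)"
      proof
        fix x assume x: "x \<in> {i \<in> S. i \<le> p}"
        then obtain n where n: "n < length xs" "x = xs ! n"
          using xs(1) by (auto simp: in_set_conv_nth)
        have "n < j - 1"
        proof (rule ccontr)
          assume "\<not> n < j - 1"
          then have "xs ! (j - 1) \<le> xs ! n"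
            using n xs by (intro sorted_nth_mono) auto
          then show False using nle x n by auto
        qed
        then show "x \<in> set (take (j - 1) xs)"
          using n by (auto simp: in_set_conv_nth)
      qed
      then have "card {i \<in> S. i \<le> p} \<le> card (set (take (j - 1) xs))"
        by (intro card_mono) auto
      also have "\<dots> \<le> j - 1" by (metis card_length length_take min.cobounded2 order_trans)
      finally show False using le assms(2) by simp
    qed
  qed
qed

locale window_problem = pl_window M \<gamma> \<mu> \<nu> x\<^sub>1 x\<^sub>2
  for M :: nat and \<gamma> \<mu> :: "nat \<Rightarrow> real" and \<nu> x\<^sub>1 x\<^sub>2 :: real +
  fixes f :: "real \<Rightarrow> real"
  assumes gamma_step: "\<forall>i\<in>{1..<M}. \<gamma> i < \<gamma> (i + 1)"
    and mu_0: "\<mu> 0 = 0"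
    and cont: "continuous_on UNIV f"
    and affine: "\<forall>i\<le>M. \<exists>c. \<forall>x. gam i \<le> ereal x \<and> ereal x < gam (i + 1) \<longrightarrow> f x = \<mu> i * x + c"
    and x12: "x\<^sub>1 < x\<^sub>2"
    and nu_pos: "\<nu> > 0"
begin

section \<open>The tilted function \<open>F\<close> on the linear segments\<close>

definition F :: "real \<Rightarrow> real" where
  "F x = f x - \<nu> * x"

definition len :: real where
  "len = x\<^sub>2 - x\<^sub>1"

lemma len_pos: "len > 0"
  using x12 by (simp add: len_def)

lemma gam_0 [simp]: "gam 0 = -\<infinity>"
  by (simp add: gam_def)

lemma gam_eq: "1 \<le> p \<Longrightarrow> p \<le> M \<Longrightarrow> gam p = ereal (\<gamma> p)"
  by (simp add: gam_def)

lemma gam_top: "p > M \<Longrightarrow> gam p = \<infinity>"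
  by (simp add: gam_def)

lemma gamma_less: "p < q \<Longrightarrow> 1 \<le> p \<Longrightarrow> q \<le> M \<Longrightarrow> \<gamma> p < \<gamma> q"
proof (induction q)
  case (Suc q)
  show ?case
  proof (cases "p = q")
    case True
    then show ?thesis using gamma_step Suc.prems by auto
  next
    case False
    then have "\<gamma> p < \<gamma> q" using Suc by auto
    also have "\<gamma> q < \<gamma> (Suc q)" using gamma_step Suc.prems False by auto
    finally show ?thesis .
  qed
qed simp

lemma gam_less: "p < q \<Longrightarrow> q \<le> M + 1 \<Longrightarrow> gam p < gam q"
  using gamma_less[of p q] by (auto simp: gam_def)

lemma gam_less_iff: "p \<le> M + 1 \<Longrightarrow> q \<le> M + 1 \<Longrightarrow> gam p < gam q \<longleftrightarrow> p < q"
  using gam_less[of p q] gam_less[of q p] by (cases p q rule: linorder_cases) (auto dest: less_asym)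

lemma gam_mono: "p \<le> q \<Longrightarrow> gam p \<le> gam q"
  using gam_less[of p q] by (cases "p = q") (auto simp: gam_def less_imp_le gamma_less)

text \<open>Continuity extends the affine formula to the right end point of the segment.\<close>

lemma F_affine:
  assumes p: "p \<le> M"
    and x: "gam p \<le> ereal x" "ereal x \<le> gam (p + 1)"
    and y: "gam p \<le> ereal y" "ereal y \<le> gam (p + 1)"
  shows "F y - F x = mt p * (y - x)"
proof -
  obtain c where c: "\<And>x. gam p \<le> ereal x \<Longrightarrow> ereal x < gam (p + 1) \<Longrightarrow> f x = \<mu> p * x + c"
    using affine p by blast
  have closed: "f z = \<mu> p * z + c" if z: "gam p \<le> ereal z" "ereal z \<le> gam (p + 1)" for z
  proof (cases "ereal z < gam (p + 1)")
    case False
    then have eq: "gam (p + 1) = ereal z" using z by auto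
    \<comment> \<open>The limit needs a left neighbourhood of \<open>z\<close> inside the segment;
      segment 0 is unbounded to the left, so there any smaller point serves.\<close>
    obtain w where w: "gam p \<le> ereal w" "w < z"
    proof (cases "p = 0")
      case True
      then show ?thesis using that[of "z - 1"] by simp
    next
      case False
      then show ?thesis using that[of "\<gamma> p"] gam_less[of p "p + 1"] p eq by (simp add: gam_eq)
    qed
    have "((\<lambda>v. f v) \<longlongrightarrow> f z) (at_left z)"
      using cont by (auto simp: continuous_on_def intro: tendsto_within_subset)
    moreover have "\<forall>\<^sub>F v in at_left z. \<mu> p * v + c = f v"
      unfolding eventually_at_left[OF w(2)]
    proof (intro exI[of _ w] conjI allI impI)
      fix v assume v: "w < v" "v < z"
      have "gam p \<le> ereal v" using w(1) v(1) by (meson ereal_less_eq(3) less_imp_le order_trans)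
      then show "\<mu> p * v + c = f v" using c v(2) eq by simp
    qed (rule w(2))
    moreover have "((\<lambda>v. \<mu> p * v + c) \<longlongrightarrow> \<mu> p * z + c) (at_left z)"
      by (intro tendsto_intros)
    ultimately show ?thesis
      by (rule tendsto_unique[OF trivial_limit_at_left_real _ Lim_transform_eventually[rotated]])
  qed (use z c in blast)
  show ?thesis
    unfolding F_def mt_def closed[OF x] closed[OF y] by (simp add: algebra_simps)
qed

lemma seg_eq: "1 \<le> p \<Longrightarrow> p < M \<Longrightarrow> seg p = F (\<gamma> (p + 1)) - F (\<gamma> p)"
  using F_affine[of p "\<gamma> p" "\<gamma> (p + 1)"] gamma_less[of p "p + 1"] by (simp add: seg_def gam_eq)

lemma sum_seg: "1 \<le> p \<Longrightarrow> p \<le> q \<Longrightarrow> q \<le> M \<Longrightarrow> (\<Sum>r = p..<q. seg r) = F (\<gamma> q) - F (\<gamma> p)"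
proof (induction q)
  case (Suc q)
  then show ?case by (cases "p = Suc q") (auto simp: seg_eq)
qed simp

text \<open>Cutting \<open>F y - F x\<close> at the breakpoints carries a property closed under
  addition from increments within one segment to longer ones. It is applied to negativity and to
  nonnegativity.\<close>

lemma F_diff_induct:
  assumes add: "\<And>u v. P u \<Longrightarrow> P v \<Longrightarrow> P (u + v)"
    and step: "\<And>p e. p\<^sub>0 \<le> p \<Longrightarrow> p < r \<Longrightarrow> e > 0 \<Longrightarrow> P (mt p * e)"
    and "r \<le> M + 1" "gam p\<^sub>0 \<le> ereal x" "x < y" "ereal y \<le> gam r"
  shows "P (F y - F x)"
  using assms(2-)
proof (induction r arbitrary: y)
  case 0
  then show ?case by simp
next
  case (Suc r)
  show ?case
  proof (cases "ereal y \<le> gam r")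
    case True
    then show ?thesis using Suc by simp
  next
    case False
    have rM: "r \<le> M" using Suc.prems by simp
    have p0r: "p\<^sub>0 \<le> r"
    proof (rule ccontr)
      assume "\<not> p\<^sub>0 \<le> r"
      then have "gam (Suc r) \<le> gam p\<^sub>0" by (intro gam_mono) simp
      then have "ereal y \<le> ereal x" using Suc.prems by (meson order_trans)
      then show False using \<open>x < y\<close> by simp
    qed
    show ?thesis
    proof (cases "gam r \<le> ereal x")
      case True
      have "F y - F x = mt r * (y - x)"
        using True False Suc.prems rM
        by (intro F_affine) (auto intro: less_imp_le order_trans[of _ "ereal y"])
      then show ?thesis using Suc.prems p0r by simp
    next
      case xr: False
      then have "r \<noteq> 0" by (auto intro!: gr0I)
      then have g: "gam r = ereal (\<gamma> r)" using rM by (simp add: gam_eq)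
      have "F y - F (\<gamma> r) = mt r * (y - \<gamma> r)"
        using False Suc.prems rM g gam_mono[of r "r + 1"] by (intro F_affine) auto
      moreover have "P (mt r * (y - \<gamma> r))" using Suc.prems p0r False g by auto
      moreover have "P (F (\<gamma> r) - F x)" using Suc g xr by auto
      ultimately have "P ((F y - F (\<gamma> r)) + (F (\<gamma> r) - F x))" by (metis add)
      then show ?thesis by simp
    qed
  qed
qed

section \<open>Counting and interlacing of the index sets \<open>A\<close> and
  \<open>B\<close>\<close>

abbreviation nA :: nat where "nA \<equiv> card setA"
abbreviation nB :: nat where "nB \<equiv> card setB"

definition countA :: "nat \<Rightarrow> nat" where "countA p = card {i \<in> setA. i \<le> p}"
definition countB :: "nat \<Rightarrow> nat" where "countB p = card {i \<in> setB. i \<le> p}"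

lemma finite_setA [simp]: "finite setA" and finite_setB [simp]: "finite setB"
  by (auto simp: setA_def setB_def)

lemma countA_Suc: "countA (Suc p) = countA p + (if Suc p \<in> setA then 1 else 0)"
proof -
  have "{i \<in> setA. i \<le> Suc p} = (if Suc p \<in> setA then insert (Suc p) {i \<in> setA. i \<le> p} else {i \<in> setA. i \<le> p})"
    by (auto simp: le_Suc_eq)
  then show ?thesis by (simp add: countA_def)
qed

lemma countB_Suc: "countB (Suc p) = countB p + (if Suc p \<in> setB then 1 else 0)"
proof -
  have "{i \<in> setB. i \<le> Suc p} = (if Suc p \<in> setB then insert (Suc p) {i \<in> setB. i \<le> p} else {i \<in> setB. i \<le> p})"
    by (auto simp: le_Suc_eq)
  then show ?thesis by (simp add: countB_def)
qed

lemma countA_0 [simp]: "countA 0 = 0"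
  by (auto simp: countA_def setA_def card_eq_0_iff)

lemma countB_0 [simp]: "countB 0 = 0"
  by (auto simp: countB_def setB_def card_eq_0_iff)

lemma countA_le: "countA p \<le> nA" and countB_le: "countB p \<le> nB"
  by (auto simp: countA_def countB_def intro!: card_mono)

text \<open>\<open>A\<close> and \<open>B\<close> record the upward and downward crossings of the
  level \<open>\<nu>\<close> by the slopes. These alternate, starting from
  \<open>\<mu> 0 = 0 < \<nu>\<close>, so the counts differ by one exactly while the current slope is
  at least \<open>\<nu>\<close>.\<close>

lemma countA_eq_countB: "p \<le> M \<Longrightarrow> countA p = countB p + (if \<mu> p \<ge> \<nu> then 1 else 0)"
proof (induction p)
  case 0
  then show ?case using mu_0 nu_pos by simp
next
  case (Suc p)
  then show ?case by (auto simp: countA_Suc countB_Suc setA_def setB_def split: if_splits)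
qed

lemma nA_eq: "nA = nB + (if \<mu> M \<ge> \<nu> then 1 else 0)"
proof -
  have "{i \<in> setA. i \<le> M} = setA" "{i \<in> setB. i \<le> M} = setB" by (auto simp: setA_def setB_def)
  then show ?thesis using countA_eq_countB[of M] by (simp add: countA_def countB_def)
qed

lemma nB_le_nA: "nB \<le> nA" and nA_le: "nA \<le> nB + 1"
  using nA_eq by auto

text \<open>The values outside the index range are chosen such that \<open>gam (ai k)\<close> and \<open>gam (bi k)\<close> are
  \<open>-\<infinity>\<close> before the first and \<open>\<infinity>\<close> after the last local extremum.\<close>

definition ai :: "nat \<Rightarrow> nat" where
  "ai k = (if k = 0 then 0 else if k \<le> nA then a k else M + 1)"

definition bi :: "nat \<Rightarrow> nat" where
  "bi k = (if k = 0 then 0 else if k \<le> nB then b k else M + 1)"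

text \<open>Thanks to the values of \<open>ai\<close> outside its index range, this holds for every
  \<open>k\<close>, including 0 and those beyond \<open>nA\<close>.\<close>

lemma ai_le_iff: "p \<le> M \<Longrightarrow> ai k \<le> p \<longleftrightarrow> k \<le> countA p"
  using sorted_list_of_set_nth_le_iff[of setA k p] countA_le[of p]
  by (auto simp: ai_def a_def countA_def)

lemma bi_le_iff: "p \<le> M \<Longrightarrow> bi k \<le> p \<longleftrightarrow> k \<le> countB p"
  using sorted_list_of_set_nth_le_iff[of setB k p] countB_le[of p]
  by (auto simp: bi_def b_def countB_def)

lemma a_in: "1 \<le> k \<Longrightarrow> k \<le> nA \<Longrightarrow> a k \<in> setA"
  using nth_mem[of "k - 1" "sorted_list_of_set setA"] by (simp add: a_def)

lemma b_in: "1 \<le> k \<Longrightarrow> k \<le> nB \<Longrightarrow> b k \<in> setB"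
  using nth_mem[of "k - 1" "sorted_list_of_set setB"] by (simp add: b_def)

lemma a_range: "1 \<le> k \<Longrightarrow> k \<le> nA \<Longrightarrow> 1 \<le> a k \<and> a k \<le> M"
  using a_in[of k] by (simp add: setA_def)

lemma b_range: "1 \<le> k \<Longrightarrow> k \<le> nB \<Longrightarrow> 1 \<le> b k \<and> b k \<le> M"
  using b_in[of k] by (simp add: setB_def)

lemma ai_le: "ai k \<le> M + 1" and bi_le: "bi k \<le> M + 1"
  using a_range[of k] b_range[of k] by (auto simp: ai_def bi_def)

lemma ai_pos: "1 \<le> k \<Longrightarrow> 1 \<le> ai k"
  using a_range[of k] by (auto simp: ai_def)

lemma bi_mono: "k < k' \<Longrightarrow> k \<le> nB \<Longrightarrow> bi k < bi k'"
proof -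
  assume k: "k < k'" "k \<le> nB"
  show ?thesis
  proof (cases "k = 0 \<or> k' > nB")
    case True
    then show ?thesis using k b_range[of k] b_range[of k'] by (auto simp: bi_def)
  next
    case False
    then have "sorted_list_of_set setB ! (k - 1) < sorted_list_of_set setB ! (k' - 1)"
      using k by (intro sorted_wrt_nth_less[OF strict_sorted_list_of_set]) auto
    then show ?thesis using False k by (simp add: bi_def b_def)
  qed
qed

text \<open>The bounds give \<open>countA p \<le> k \<le> countB p\<close>, so the counts are equal,
  which forces a slope below \<open>\<nu>\<close>. In \<open>mt_nonneg\<close> the bounds force them
  apart instead.\<close>

lemma mt_neg: "bi k \<le> p \<Longrightarrow> p < ai (k + 1) \<Longrightarrow> mt p < 0"
  using ai_le_iff[of p "k + 1"] bi_le_iff[of p k] countA_eq_countB[of p] ai_le[of "k + 1"]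
  by (auto simp: mt_def split: if_splits)

lemma mt_nonneg: "ai (k + 1) \<le> p \<Longrightarrow> p < bi (k + 1) \<Longrightarrow> mt p \<ge> 0"
  using ai_le_iff[of p "k + 1"] bi_le_iff[of p "k + 1"] countA_eq_countB[of p] bi_le[of "k + 1"]
  by (auto simp: mt_def split: if_splits)

text \<open>If the order failed, counting would make \<open>ai k\<close> and \<open>bi k\<close> the
  same index, which cannot be a crossing in both directions. The case \<open>k = nB + 1\<close> is
  included, with \<open>bi k = M + 1\<close>.\<close>

lemma ai_less_bi:
  assumes "1 \<le> k" "k \<le> nA"
  shows "ai k < bi k"
proof (rule ccontr)
  assume n: "\<not> ai k < bi k"
  have M: "ai k \<le> M" using a_range assms by (simp add: ai_def)
  then have "k \<le> countB (bi k)" using bi_le_iff[of "bi k" k] n by auto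
  then have "k \<le> countA (bi k)" using countA_eq_countB[of "bi k"] n M by auto
  then have eq: "ai k = bi k" using ai_le_iff[of "bi k" k] n M by auto
  then have "k \<le> nB" using M assms by (auto simp: bi_def split: if_splits)
  then show False using eq a_in[of k] b_in[of k] assms by (auto simp: ai_def bi_def setA_def setB_def)
qed

text \<open>At a downward crossing both counts agree, so \<open>k + 1\<close> elements of
  \<open>A\<close> up to \<open>bi k\<close> would entail \<open>k + 1\<close> elements of
  \<open>B\<close> up to the \<open>k\<close>-th one.\<close>

lemma bi_less_ai:
  assumes "k \<le> nB"
  shows "bi k < ai (k + 1)"
proof (rule ccontr)
  assume n: "\<not> bi k < ai (k + 1)"
  have M: "bi k \<le> M" using b_range[of k] assms by (simp add: bi_def)
  have c: "k + 1 \<le> countA (bi k)" using ai_le_iff[of "bi k" "k + 1"] n M by auto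
  then have "k \<noteq> 0" by (auto simp: bi_def intro!: gr0I)
  then have "\<mu> (bi k) < \<nu>" using b_in[of k] assms by (simp add: bi_def setB_def)
  then have "k + 1 \<le> countB (bi k)" using c countA_eq_countB[of "bi k"] M by simp
  then have "bi (k + 1) \<le> bi k" using bi_le_iff M by blast
  then show False using bi_mono[of k "k + 1"] assms by simp
qed

section \<open>Monotone stretches of \<open>F\<close>\<close>

lemma F_decreasing:
  assumes "gam (bi k) \<le> ereal x" "x < y" "ereal y \<le> gam (ai (k + 1))"
  shows "F y < F x"
proof -
  have "F y - F x < 0"
    by (rule F_diff_induct[where P = "\<lambda>u. u < 0", OF _ _ ai_le assms])
      (use mt_neg[of k] in \<open>auto intro!: mult_neg_pos\<close>)
  then show ?thesis by simp
qed

lemma F_increasing: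
  assumes "gam (ai (k + 1)) \<le> ereal x" "x \<le> y" "ereal y \<le> gam (bi (k + 1))"
  shows "F x \<le> F y"
proof (cases "x = y")
  case False
  then have "F y - F x \<ge> 0"
    using assms by (intro F_diff_induct[where P = "\<lambda>u. u \<ge> 0" and r = "bi (k + 1)" and p\<^sub>0 = "ai (k + 1)", OF _ _ bi_le])
      (use mt_nonneg[of k] in auto)
  then show ?thesis by simp
qed simp

lemma F_cont: "continuous_on S F"
  unfolding F_def by (intro continuous_intros continuous_on_subset[OF cont]) auto

lemma exists_bi: "\<exists>k\<le>nB. gam (bi k) \<le> ereal y \<and> ereal y < gam (bi (k + 1))"
proof -
  let ?S = "{k. k \<le> nB \<and> gam (bi k) \<le> ereal y}"
  have fin: "finite ?S" by (rule finite_subset[of _ "{..nB}"]) auto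
  have 0: "0 \<in> ?S" by (simp add: bi_def)
  have m: "Max ?S \<in> ?S" using fin 0 by (intro Max_in) auto
  have "\<not> gam (bi (Max ?S + 1)) \<le> ereal y"
  proof
    assume g: "gam (bi (Max ?S + 1)) \<le> ereal y"
    have "Max ?S + 1 \<notin> ?S" using Max_ge[OF fin, of "Max ?S + 1"] by linarith
    then have "Max ?S + 1 > nB" using g by simp
    then show False using g by (auto simp: bi_def gam_top)
  qed
  then show ?thesis using m by auto
qed

section \<open>Jump times\<close>

lemma gam_ai_neq_MInf: "gam (ai (k + 1)) \<noteq> -\<infinity>"
  using ai_pos[of "k + 1"] by (auto simp: gam_def)

text \<open>Right end of the window \<open>[s, s + len]\<close>, cut off at the local minimum following the
  \<open>k\<close>-th local maximum.\<close>

definition win_end :: "nat \<Rightarrow> real \<Rightarrow> real" where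
  "win_end k s = real_of_ereal (min (ereal (s + len)) (gam (ai (k + 1))))"

lemma ereal_win_end: "ereal (win_end k s) = min (ereal (s + len)) (gam (ai (k + 1)))"
  using gam_ai_neq_MInf[of k] unfolding win_end_def
  by (intro ereal_real') (cases "gam (ai (k + 1))"; auto simp: min_def)

lemma win_end_le_ai: "ereal (win_end k s) \<le> gam (ai (k + 1))"
  by (simp add: ereal_win_end)

lemma win_end_le: "win_end k s \<le> s + len"
proof -
  have "ereal (win_end k s) \<le> ereal (s + len)" unfolding ereal_win_end by (rule min.cobounded1)
  then show ?thesis by simp
qed

lemma win_end_greatest: "y \<le> s + len \<Longrightarrow> ereal y \<le> gam (ai (k + 1)) \<Longrightarrow> y \<le> win_end k s"
proof -
  assume "y \<le> s + len" "ereal y \<le> gam (ai (k + 1))"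
  then have "ereal y \<le> ereal (win_end k s)" unfolding ereal_win_end by simp
  then show ?thesis by simp
qed

lemma win_end_cases: "win_end k s = s + len \<or> ereal (win_end k s) = gam (ai (k + 1))"
  using ereal_win_end[of k s] by (auto simp: min_def split: if_splits)

lemma win_end_mono: "s \<le> s' \<Longrightarrow> win_end k s \<le> win_end k s'"
  using win_end_le[of k s] win_end_le_ai[of k s] by (intro win_end_greatest) auto

text \<open>Once the right end of the window has passed the \<open>k\<close>-th local maximum, the
  cut-off end has too: it then travels on the decreasing stretch between \<open>bi k\<close> and
  \<open>ai (k + 1)\<close>.\<close>

lemma win_end_ge_bi: "k \<le> nB \<Longrightarrow> gam (bi k) \<le> ereal (s + len) \<Longrightarrow> gam (bi k) \<le> ereal (win_end k s)"
  using bi_less_ai[of k] gam_mono[of "bi k" "ai (k + 1)"] by (simp add: ereal_win_end)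

lemma gam_bi: "1 \<le> k \<Longrightarrow> k \<le> nB \<Longrightarrow> gam (bi k) = ereal (\<gamma> (b k))"
  using b_range[of k] by (simp add: bi_def gam_eq)

section \<open>Minimum of \<open>F\<close> over an interval\<close>

definition win_min :: "real \<Rightarrow> real \<Rightarrow> real" where
  "win_min s u = Inf (F ` {s..u})"

lemma win_min_le: "s \<le> y \<Longrightarrow> y \<le> u \<Longrightarrow> win_min s u \<le> F y"
  unfolding win_min_def
  by (intro cInf_lower bounded_imp_bdd_below compact_imp_bounded compact_continuous_image F_cont) auto

lemma win_min_eqI: "s \<le> y \<Longrightarrow> y \<le> u \<Longrightarrow> (\<And>z. s \<le> z \<Longrightarrow> z \<le> u \<Longrightarrow> F y \<le> F z) \<Longrightarrow> win_min s u = F y"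
  unfolding win_min_def by (intro cInf_eq_minimum) auto

lemma le_mn: "s \<le> u \<Longrightarrow> (\<And>z. s \<le> z \<Longrightarrow> z \<le> u \<Longrightarrow> c \<le> F z) \<Longrightarrow> c \<le> win_min s u"
  unfolding win_min_def by (intro cInf_greatest) auto

text \<open>The minimisers form a nonempty compact set, which has a least element. The strict
  inequality to its left is what keeps it off the nondecreasing stretches in
  \<open>later_jump_if_beaten\<close>.\<close>

lemma least_minimizer:
  assumes "s \<le> u"
  obtains z where "s \<le> z" "z \<le> u" "win_min s u = F z" "\<And>y. s \<le> y \<Longrightarrow> y < z \<Longrightarrow> F z < F y"
proof -
  let ?Z = "{z \<in> {s..u}. F z = win_min s u}"
  obtain y where y: "y \<in> {s..u}" "\<And>z. z \<in> {s..u} \<Longrightarrow> F y \<le> F z"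
    using continuous_attains_inf[OF compact_Icc _ F_cont, of s u] assms by auto
  then have "win_min s u = F y" by (intro win_min_eqI) auto
  then have ne: "?Z \<noteq> {}" using y(1) by auto
  have "?Z = {s..u} \<inter> F -` {win_min s u}" by auto
  moreover have "closed ({s..u} \<inter> F -` {win_min s u})"
    by (intro continuous_closed_preimage F_cont) auto
  ultimately have "compact ?Z" by (metis compact_Icc compact_Int_closed Int_assoc inf.idem)
  then obtain z where z: "z \<in> ?Z" "\<And>w. w \<in> ?Z \<Longrightarrow> z \<le> w"
    using ne compact_attains_inf by (metis (no_types, lifting))
  show ?thesis
  proof
    fix y assume y: "s \<le> y" "y < z"
    then have "win_min s u \<le> F y" using z(1) by (intro win_min_le) auto
    moreover have "F y \<noteq> win_min s u" using z(2)[of y] y z(1) by auto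
    ultimately show "F z < F y" using z(1) by auto
  qed (use z in auto)
qed

lemma win_min_attained: "s \<le> u \<Longrightarrow> \<exists>y. s \<le> y \<and> y \<le> u \<and> win_min s u = F y"
  by (erule least_minimizer) blast

lemma win_min_split:
  assumes "s \<le> v" "v \<le> u"
  shows "win_min s u = min (win_min s v) (win_min v u)"
proof (rule antisym)
  obtain y z where "s \<le> y" "y \<le> v" "win_min s v = F y" "v \<le> z" "z \<le> u" "win_min v u = F z"
    using win_min_attained assms by metis
  then show "win_min s u \<le> min (win_min s v) (win_min v u)" using assms by (auto intro!: win_min_le)
  show "min (win_min s v) (win_min v u) \<le> win_min s u"
  proof (rule le_mn)
    fix z assume "s \<le> z" "z \<le> u"
    then show "min (win_min s v) (win_min v u) \<le> F z"
      using win_min_le[of s z v] win_min_le[of v z u] by (cases "z \<le> v") (auto simp: min_le_iff_disj)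
  qed (use assms in simp)
qed

lemma win_min_mono_left: "s \<le> s' \<Longrightarrow> s' \<le> u \<Longrightarrow> win_min s u \<le> win_min s' u"
  using win_min_split[of s s' u] by simp

text \<open>The quantity \<open>\<delta>\<close> of the algorithm when the window starts at \<open>s\<close>.\<close>

definition D :: "nat \<Rightarrow> real \<Rightarrow> real" where
  "D k s = F (win_end k s) - win_min s (\<gamma> (b k))"

text \<open>The search runs from the moment when the right end of the window reaches the
  \<open>k\<close>-th local maximum to the moment when the left end does; \<open>\<sigma>\<close> is
  the position of the left end.\<close>

definition jump :: "nat \<Rightarrow> real \<Rightarrow> bool" where
  "jump k \<sigma> \<longleftrightarrow> \<gamma> (b k) - len \<le> \<sigma> \<and> \<sigma> \<le> \<gamma> (b k) \<and> D k \<sigma> \<le> 0 \<and>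
     (\<forall>s. \<gamma> (b k) - len \<le> s \<and> s < \<sigma> \<longrightarrow> D k s > 0)"

text \<open>The condition tested by the inner loop of Section C. If the window is not cut off, the
  only \<open>y\<close> in question is \<open>win_end k \<sigma>\<close> itself.\<close>

definition feasible :: "nat \<Rightarrow> real \<Rightarrow> bool" where
  "feasible k \<sigma> \<longleftrightarrow> (\<forall>y. win_end k \<sigma> \<le> y \<and> y \<le> \<sigma> + len \<longrightarrow> F (win_end k \<sigma>) \<le> F y)"

lemma jump_unique: "jump k \<sigma> \<Longrightarrow> jump k \<sigma>' \<Longrightarrow> \<sigma> = \<sigma>'"
  unfolding jump_def by (metis linorder_less_linear not_less)

lemma F_win_end_antimono:
  assumes "1 \<le> k" "k \<le> nB" "\<gamma> (b k) - len \<le> s" "s \<le> s'"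
  shows "F (win_end k s') \<le> F (win_end k s)"
proof (cases "win_end k s = win_end k s'")
  case False
  then have "win_end k s < win_end k s'" using win_end_mono assms by (simp add: less_le)
  moreover have "gam (bi k) \<le> ereal (win_end k s)"
    using assms by (intro win_end_ge_bi) (auto simp: gam_bi)
  ultimately show ?thesis using F_decreasing[of k] win_end_le_ai[of k s'] less_imp_le by blast
qed simp

text \<open>The value at the cut-off end falls, while the interval from \<open>s\<close> to
  \<open>\<gamma> (b k)\<close> shrinks, so that its minimum cannot fall.\<close>

lemma D_antimono:
  assumes "1 \<le> k" "k \<le> nB" "\<gamma> (b k) - len \<le> s" "s \<le> s'" "s' \<le> \<gamma> (b k)"
  shows "D k s' \<le> D k s"
  using F_win_end_antimono[OF assms(1-4)] win_min_mono_left[OF assms(4,5)] by (simp add: D_def)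

section \<open>Correctness of the algorithm\<close>

lemma exists_gam: "\<exists>h\<le>M. gam h \<le> ereal y \<and> ereal y < gam (h + 1)"
proof -
  let ?S = "{h. h \<le> M \<and> gam h \<le> ereal y}"
  have fin: "finite ?S" by (rule finite_subset[of _ "{..M}"]) auto
  have m: "Max ?S \<in> ?S" using fin by (intro Max_in) auto
  have "\<not> gam (Max ?S + 1) \<le> ereal y"
  proof
    assume g: "gam (Max ?S + 1) \<le> ereal y"
    have "Max ?S + 1 \<notin> ?S" using Max_ge[OF fin, of "Max ?S + 1"] by linarith
    then show False using g gam_top[of "Max ?S + 1"] by auto
  qed
  then show ?thesis using m by auto
qed

lemma exists_gam_left: "\<exists>h\<le>M. gam h < ereal y \<and> ereal y \<le> gam (h + 1)"
proof -
  let ?S = "{h. h \<le> M \<and> gam h < ereal y}"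
  have fin: "finite ?S" by (rule finite_subset[of _ "{..M}"]) auto
  have m: "Max ?S \<in> ?S" using fin by (intro Max_in) auto
  have "\<not> gam (Max ?S + 1) < ereal y"
  proof
    assume g: "gam (Max ?S + 1) < ereal y"
    have "Max ?S + 1 \<notin> ?S" using Max_ge[OF fin, of "Max ?S + 1"] by linarith
    then show False using g gam_top[of "Max ?S + 1"] by auto
  qed
  then show ?thesis using m by auto
qed

lemma win_min_segment:
  assumes "p \<le> M" "gam p \<le> ereal x" "x \<le> y" "ereal y \<le> gam (p + 1)"
  shows "win_min x y = min (F x) (F y)"
proof -
  have aff: "F z = F x + mt p * (z - x)" if "x \<le> z" "z \<le> y" for z
  proof -
    have "ereal x \<le> ereal z" "ereal z \<le> ereal y" "ereal x \<le> ereal y" using that by auto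
    then have "gam p \<le> ereal z" "ereal z \<le> gam (p + 1)" "ereal x \<le> gam (p + 1)"
      using assms by (blast intro: order_trans)+
    then show ?thesis using F_affine[of p x z] assms by simp
  qed
  show ?thesis
  proof (cases "mt p \<ge> 0")
    case True
    then have le: "F x \<le> F z" if "x \<le> z" "z \<le> y" for z using aff[of z] True that by simp
    then show ?thesis using win_min_eqI[of x x y] assms(3) by (simp add: min_def)
  next
    case False
    have le: "F y \<le> F z" if "x \<le> z" "z \<le> y" for z
      using False that aff[of z] aff[of y] assms(3) by (simp add: mult_left_mono_neg)
    then have "win_min x y = F y" using assms(3) by (intro win_min_eqI) auto
    moreover have "F y \<le> F x" using le[of x] assms(3) by blast
    ultimately show ?thesis by linarith
  qed
qed

text \<open>If \<open>d\<close> is the value at \<open>\<gamma> n\<close> minus the running minimum,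
  adding \<open>seg n\<close> moves the reference value to the next breakpoint, and truncation at 0
  covers the case that this breakpoint is the new minimum.\<close>

lemma fold_pos_part:
  assumes "gam h \<le> ereal s" "s \<le> \<gamma> (h + 1)" "h + 1 \<le> n" "n \<le> M"
  shows "fold (\<lambda>p d. max 0 (d + seg p)) [h + 1..<n] (max 0 (F (\<gamma> (h + 1)) - F s))
    = F (\<gamma> n) - win_min s (\<gamma> n)"
  using assms(3,4)
proof (induction n rule: dec_induct)
  case base
  then have "win_min s (\<gamma> (h + 1)) = min (F s) (F (\<gamma> (h + 1)))"
    using assms by (intro win_min_segment[of h]) (auto simp: gam_eq)
  then show ?case by simp
next
  case (step n)
  have sn: "s \<le> \<gamma> n" using assms(2) gamma_less[of "h + 1" n] step by (cases "n = h + 1") auto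
  have nn: "\<gamma> n < \<gamma> (Suc n)" using step by (intro gamma_less) auto
  have "win_min (\<gamma> n) (\<gamma> (Suc n)) = min (F (\<gamma> n)) (F (\<gamma> (Suc n)))"
    using step nn by (intro win_min_segment[of n]) (auto simp: gam_eq)
  moreover have "win_min s (\<gamma> n) \<le> F (\<gamma> n)" using sn by (intro win_min_le) auto
  ultimately have "win_min s (\<gamma> (Suc n)) = min (win_min s (\<gamma> n)) (F (\<gamma> (Suc n)))"
    using win_min_split[OF sn less_imp_le[OF nn]] by simp
  moreover have "seg n = F (\<gamma> (Suc n)) - F (\<gamma> n)" using seg_eq[of n] step by simp
  ultimately show ?case using step by simp
qed

lemma pos_part_iter_eq:
  assumes k: "1 \<le> k" "k \<le> nB" and h: "h \<le> b k" "gam h \<le> ereal s" "ereal s \<le> gam (h + 1)" "s \<le> \<gamma> (b k)"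
  shows "pos_part_iter k h s = F (\<gamma> (b k)) - win_min s (\<gamma> (b k))"
proof (cases "h = b k")
  case True
  have bk: "1 \<le> b k" "b k \<le> M" using b_range k by auto
  then have s: "s = \<gamma> (b k)" using True h by (simp add: gam_eq)
  \<comment> \<open>For \<open>b k = M\<close> the factor \<open>gam (b k + 1) - s\<close> is
    infinite; the slope being negative, the product is still negative and the maximum is 0.\<close>
  have "mt (b k) < 0" using b_in[OF k] by (simp add: mt_def setB_def)
  moreover have "ereal s < gam (b k + 1)" using s gam_less[of "b k" "b k + 1"] bk by (simp add: gam_eq)
  ultimately have "max 0 (ereal (mt h) * (gam (h + 1) - ereal s)) = 0"
    unfolding True by (cases "gam (b k + 1)") (auto simp: max_def mult_less_0_iff zero_le_mult_iff)
  moreover have "win_min s (\<gamma> (b k)) = F (\<gamma> (b k))" unfolding s by (intro win_min_eqI) auto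
  ultimately show ?thesis unfolding pos_part_iter_def by (simp add: True)
next
  case False
  have hb: "h < b k" and bk: "b k \<le> M" using False h b_range k by auto
  then have g: "gam (h + 1) = ereal (\<gamma> (h + 1))" by (intro gam_eq) auto
  have "F (\<gamma> (h + 1)) - F s = mt h * (\<gamma> (h + 1) - s)"
    using h g hb bk gam_mono[of h "h + 1"] by (intro F_affine) auto
  then have "real_of_ereal (max 0 (ereal (mt h) * (gam (h + 1) - ereal s))) = max 0 (F (\<gamma> (h + 1)) - F s)"
    using g by (simp add: max_def)
  then show ?thesis unfolding pos_part_iter_def
    using fold_pos_part[of h s "b k"] h g hb bk by simp
qed

text \<open>In run \<open>k\<close> an element \<open>a (k + 1)\<close> is missing only if
  \<open>k = nB = nA\<close>, just the case in which \<open>aa\<close> inserts its sentinel.\<close>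

lemma aa_eq: "k \<le> nB \<Longrightarrow> q \<le> k + 1 \<Longrightarrow> aa k q = ai q"
  using nB_le_nA nA_le by (auto simp: aa_def ai_def)

lemma bk_less_ai: "1 \<le> k \<Longrightarrow> k \<le> nB \<Longrightarrow> b k < ai (k + 1)"
  using bi_less_ai[of k] by (simp add: bi_def)

text \<open>With the left end on the local maximum, the interval for the minimum is a single point,
  and the cut-off end has descended from that height. Thus no loop gets past this position with
  \<open>D\<close> positive.\<close>

lemma D_at_peak:
  assumes "1 \<le> k" "k \<le> nB"
  shows "D k (\<gamma> (b k)) \<le> 0"
proof -
  have "win_end k (\<gamma> (b k) - len) = \<gamma> (b k)"
    using win_end_ge_bi[of k "\<gamma> (b k) - len"] win_end_le[of k "\<gamma> (b k) - len"] assms by (simp add: gam_bi)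
  then have "F (win_end k (\<gamma> (b k))) \<le> F (\<gamma> (b k))"
    using F_win_end_antimono[of k "\<gamma> (b k) - len" "\<gamma> (b k)"] assms len_pos by simp
  moreover have "win_min (\<gamma> (b k)) (\<gamma> (b k)) = F (\<gamma> (b k))" by (intro win_min_eqI) auto
  ultimately show ?thesis by (simp add: D_def)
qed

text \<open>Specification of a loop state entered with left end \<open>\<tau>\<close>. Searching
  only from \<open>\<tau>\<close> on lets the claim be proved by induction over the rounds.\<close>

definition finds_jump :: "nat \<Rightarrow> real \<Rightarrow> ereal option \<Rightarrow> bool" where
  "finds_jump k \<tau> w \<longleftrightarrow> (\<exists>\<sigma>. \<tau> \<le> \<sigma> \<and> \<sigma> \<le> \<gamma> (b k) \<and> D k \<sigma> \<le> 0 \<and> (\<forall>s. \<tau> \<le> s \<and> s < \<sigma> \<longrightarrow> D k s > 0)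
     \<and> w = Some (if feasible k \<sigma> then ereal (\<sigma> - x\<^sub>1) else \<infinity>))"

text \<open>By \<open>D_antimono\<close>, a positive value at \<open>\<tau>'\<close> excludes all
  positions between \<open>\<tau>\<close> and \<open>\<tau>'\<close>, so the search may resume at
  \<open>\<tau>'\<close>.\<close>

lemma finds_jump_step:
  assumes "1 \<le> k" "k \<le> nB" "\<gamma> (b k) - len \<le> \<tau>" "\<tau> \<le> \<tau>'" "\<tau>' \<le> \<gamma> (b k)" "D k \<tau>' > 0"
    and "finds_jump k \<tau>' w"
  shows "finds_jump k \<tau> w"
proof -
  obtain \<sigma> where \<sigma>: "\<tau>' \<le> \<sigma>" "\<sigma> \<le> \<gamma> (b k)" "D k \<sigma> \<le> 0" "\<forall>s. \<tau>' \<le> s \<and> s < \<sigma> \<longrightarrow> D k s > 0"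
    "w = Some (if feasible k \<sigma> then ereal (\<sigma> - x\<^sub>1) else \<infinity>)"
    using assms(7) unfolding finds_jump_def by blast
  have "D k s > 0" if "\<tau> \<le> s" "s < \<sigma>" for s
  proof (cases "\<tau>' \<le> s")
    case False
    then have "D k \<tau>' \<le> D k s" using that assms by (intro D_antimono) auto
    then show ?thesis using assms by simp
  qed (use that \<sigma> in blast)
  then show ?thesis unfolding finds_jump_def using \<sigma> assms by (intro exI[of _ \<sigma>]) auto
qed

text \<open>\<open>\<phi>\<close> is the height of \<open>F\<close> at \<open>\<gamma> r\<close>
  above \<open>c\<close>. As \<open>F\<close> is affine on each segment, checking the breakpoints
  and \<open>\<theta>\<close> detects every point below \<open>c\<close>. The conditions on
  \<open>\<phi>\<close> are guarded because at \<open>r = k + 1\<close> the range of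
  \<open>y\<close> is empty.\<close>

lemma phi_neg_iff:
  assumes "k \<le> M" "gam k < ereal \<theta>" "ereal \<theta> \<le> gam (k + 1)"
    and "1 \<le> r" "r \<le> k + 1" "r \<le> k \<Longrightarrow> \<phi> = F (\<gamma> r) - c" "r \<le> k \<Longrightarrow> 0 \<le> \<phi>"
  shows "phi_neg k \<theta> r \<phi> \<longleftrightarrow> (\<exists>y. gam r < ereal y \<and> y \<le> \<theta> \<and> F y < c)"
  using assms(4-)
proof (induction "k + 1 - r" arbitrary: r \<phi>)
  case 0
  then have r: "r = k + 1" by simp
  have "\<not> gam r < ereal y" if "y \<le> \<theta>" for y
    using assms(3) that r by (metis ereal_less_eq(3) not_less order_trans)
  then show ?case unfolding phi_neg.simps[of k \<theta> r] by (auto simp: r)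
next
  case (Suc n)
  then have rk: "r \<le> k" by simp
  have gr: "gam r = ereal (\<gamma> r)" using Suc rk assms(1) by (simp add: gam_eq)
  define v where "v = (if r < k then \<gamma> (r + 1) else \<theta>)"
  define \<phi>' where "\<phi>' = \<phi> + (if r < k then seg r else mt r * (\<theta> - \<gamma> r))"
  have v: "\<gamma> r < v" "ereal v \<le> gam (r + 1)" "v \<le> \<theta>"
  proof -
    show "\<gamma> r < v" "ereal v \<le> gam (r + 1)"
      using rk assms Suc.prems gamma_less[of r "r + 1"] gr gam_eq[of "r + 1"] by (auto simp: v_def)
    have "r < k \<Longrightarrow> gam (r + 1) < ereal \<theta>"
      using gam_mono[of "r + 1" k] assms(2) by auto
    then show "v \<le> \<theta>" using gam_eq[of "r + 1"] assms(1) by (auto simp: v_def)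
  qed
  have aff: "F y - F (\<gamma> r) = mt r * (y - \<gamma> r)" if "\<gamma> r \<le> y" "y \<le> v" for y
  proof -
    have "ereal y \<le> ereal v" using that by simp
    then have "ereal y \<le> gam (r + 1)" using v(2) by (rule order_trans)
    then show ?thesis using that gr rk assms(1) gam_mono[of r "r + 1"] by (intro F_affine) auto
  qed
  have \<phi>': "\<phi>' = F v - c"
  proof (cases "r < k")
    case True
    then show ?thesis using seg_eq[of r] assms(1) Suc.prems by (simp add: \<phi>'_def v_def)
  next
    case False
    then show ?thesis using aff[of v] v Suc.prems rk by (simp add: \<phi>'_def v_def)
  qed
  have unf: "phi_neg k \<theta> r \<phi> \<longleftrightarrow> \<phi>' < 0 \<or> phi_neg k \<theta> (r + 1) \<phi>'"
    using rk by (subst phi_neg.simps) (simp add: \<phi>'_def Let_def)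
  show ?case
  proof (cases "\<phi>' < 0")
    case True
    then have "gam r < ereal v \<and> v \<le> \<theta> \<and> F v < c" using v gr \<phi>' by simp
    then show ?thesis using unf True by blast
  next
    case False
    \<comment> \<open>\<open>F\<close> is at least \<open>c\<close> at both ends; with a nonnegative
      slope the left end is the lowest point, otherwise the right end \<open>v\<close> is.\<close>
    have nonneg: "c \<le> F y" if "\<gamma> r \<le> y" "y \<le> v" for y
    proof (cases "mt r \<ge> 0")
      case True
      then have "0 \<le> mt r * (y - \<gamma> r)" using that by simp
      then show ?thesis using aff[OF that] Suc.prems rk by simp
    next
      case mr: False
      have "mt r * (v - \<gamma> r) \<le> mt r * (y - \<gamma> r)" using that mr by (intro mult_left_mono_neg) auto
      then show ?thesis using aff[OF that] aff[of v] v False \<phi>' by simp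
    qed
    have IH: "phi_neg k \<theta> (r + 1) \<phi>' \<longleftrightarrow> (\<exists>y. gam (r + 1) < ereal y \<and> y \<le> \<theta> \<and> F y < c)"
      using Suc.hyps(2) rk False \<phi>' by (intro Suc.hyps(1)) (auto simp: v_def)
    have "(\<exists>y. gam (r + 1) < ereal y \<and> y \<le> \<theta> \<and> F y < c) \<longleftrightarrow> (\<exists>y. gam r < ereal y \<and> y \<le> \<theta> \<and> F y < c)"
    proof (intro iffI; elim exE conjE)
      fix y assume "gam (r + 1) < ereal y" "y \<le> \<theta>" "F y < c"
      then show "\<exists>y. gam r < ereal y \<and> y \<le> \<theta> \<and> F y < c"
        using gam_mono[of r "r + 1"] by (intro exI[of _ y]) auto
    next
      fix y assume y: "gam r < ereal y" "y \<le> \<theta>" "F y < c"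
      then have vy: "v < y" using nonneg[of y] gr by (auto simp: not_less[symmetric])
      then have "r < k" using y by (auto simp: v_def split: if_splits)
      then have "gam (r + 1) = ereal v" using gam_eq[of "r + 1"] assms(1) by (simp add: v_def)
      then show "\<exists>y. gam (r + 1) < ereal y \<and> y \<le> \<theta> \<and> F y < c" using y vy by (intro exI[of _ y]) auto
    qed
    then show ?thesis using unf False IH by simp
  qed
qed

text \<open>The window is cut off at \<open>\<gamma> (ai (k + 1))\<close>, and the inner loop starts
  there with height 0; it finds a negative height exactly when a better point follows inside the
  window.\<close>

lemma outputC_eq:
  assumes k: "1 \<le> k" "k \<le> nB" and A: "ai (k + 1) \<le> M" and le: "\<gamma> (ai (k + 1)) \<le> \<sigma> + len"
  shows "outputC k \<sigma> = (if feasible k \<sigma> then ereal (\<sigma> - x\<^sub>1) else \<infinity>)"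
proof -
  define \<theta> where "\<theta> = \<sigma> + len"
  define n where "n = (THE n. n \<le> M \<and> gam n < ereal \<theta> \<and> ereal \<theta> \<le> gam (n + 1))"
  let ?c = "\<gamma> (ai (k + 1))"
  have gA: "gam (ai (k + 1)) = ereal ?c" using A ai_pos[of "k + 1"] by (intro gam_eq) auto
  have "\<exists>!n. n \<le> M \<and> gam n < ereal \<theta> \<and> ereal \<theta> \<le> gam (n + 1)"
  proof (rule ex_ex1I)
    show "\<exists>n. n \<le> M \<and> gam n < ereal \<theta> \<and> ereal \<theta> \<le> gam (n + 1)" using exists_gam_left by auto
    fix p q assume pq: "p \<le> M \<and> gam p < ereal \<theta> \<and> ereal \<theta> \<le> gam (p + 1)"
      "q \<le> M \<and> gam q < ereal \<theta> \<and> ereal \<theta> \<le> gam (q + 1)"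
    then have "gam p < gam (q + 1)" "gam q < gam (p + 1)" by (metis less_le_trans)+
    then show "p = q" using pq gam_less_iff[of p "q + 1"] gam_less_iff[of q "p + 1"] by simp
  qed
  from theI'[OF this, folded n_def]
  have n: "n \<le> M" "gam n < ereal \<theta>" "ereal \<theta> \<le> gam (n + 1)" by auto
  have "gam (ai (k + 1)) \<le> gam (n + 1)" using gA le n(3) order_trans[of "ereal ?c" "ereal \<theta>"] by (simp add: \<theta>_def)
  then have An: "ai (k + 1) \<le> n + 1" using gam_less_iff[of "n + 1" "ai (k + 1)"] n A by (meson ai_le not_less add_le_mono1)
  have win_end: "win_end k \<sigma> = ?c" using ereal_win_end[of k \<sigma>] gA le by (simp add: min_def split: if_splits)
  have "phi_neg n \<theta> (ai (k + 1)) 0 \<longleftrightarrow> (\<exists>y. gam (ai (k + 1)) < ereal y \<and> y \<le> \<theta> \<and> F y < F ?c)"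
    using n An ai_pos[of "k + 1"] by (intro phi_neg_iff) auto
  also have "\<dots> \<longleftrightarrow> \<not> feasible k \<sigma>"
    unfolding feasible_def win_end gA \<theta>_def by (auto simp: not_le le_less)
  finally show ?thesis
    unfolding outputC_def Let_def using aa_eq[of k "k + 1"] k by (simp add: n_def \<theta>_def len_def)
qed

text \<open>The right end has passed the local minimum, so \<open>win_end\<close> stays at the
  constant \<open>c\<close> and only the minimum on the left changes. Each \<open>\<delta>\<close>
  is \<open>D k\<close> at the next breakpoint; the jump lies in the first segment at whose end it
  is not positive.\<close>

lemma sectionC_correct:
  assumes k: "1 \<le> k" "k \<le> nB" and A: "ai (k + 1) \<le> M"
    and "h < b k" "gam h \<le> ereal \<tau>" "\<tau> < \<gamma> (h + 1)" "\<gamma> (ai (k + 1)) \<le> \<tau> + len" "\<gamma> (b k) - len \<le> \<tau>"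
    and "d = D k \<tau>" "d > 0"
  shows "finds_jump k \<tau> (sectionC k h \<tau> d)"
  using assms(4-)
proof (induction "b k - h" arbitrary: h \<tau> d rule: less_induct)
  case less
  define c where "c = \<gamma> (ai (k + 1))"
  define \<tau>' where "\<tau>' = \<gamma> (h + 1)"
  have gA: "gam (ai (k + 1)) = ereal c" using A ai_pos[of "k + 1"] unfolding c_def by (intro gam_eq) auto
  have bM: "b k \<le> M" using b_range k by auto
  have g: "gam (h + 1) = ereal \<tau>'" using bM less.prems unfolding \<tau>'_def by (intro gam_eq) auto
  have win_end: "win_end k s = c" if "\<tau> \<le> s" for s
    using ereal_win_end[of k s] gA less.prems that by (simp add: min_def c_def split: if_splits)
  have \<tau>\<tau>': "\<tau> < \<tau>'" using less.prems by (simp add: \<tau>'_def)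
  have \<tau>'b: "\<tau>' \<le> \<gamma> (b k)" unfolding \<tau>'_def using less.prems bM gamma_less[of "h + 1" "b k"]
    by (cases "h + 1 = b k") auto
  have sum: "(\<Sum>p = b k..<aa k (k + 1). seg p) = F c - F (\<gamma> (b k))"
    using sum_seg[of "b k" "ai (k + 1)"] bk_less_ai[OF k] A b_range[OF k] k by (simp add: aa_eq c_def)
  define \<delta> where "\<delta> = (if h + 1 < b k then pos_part_iter k (h + 1) (\<tau> + (\<gamma> (h + 1) - \<tau>)) else 0)
                + (\<Sum>p = b k..<aa k (k + 1). seg p)"
  have \<delta>: "\<delta> = D k \<tau>'"
  proof (cases "h + 1 < b k")
    case True
    have "pos_part_iter k (h + 1) \<tau>' = F (\<gamma> (b k)) - win_min \<tau>' (\<gamma> (b k))"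
      using True \<tau>'b g gam_mono[of "h + 1" "h + 1 + 1"] by (intro pos_part_iter_eq[OF k]) auto
    then show ?thesis using True sum win_end[of \<tau>'] \<tau>\<tau>' by (simp add: \<delta>_def D_def \<tau>'_def)
  next
    case False
    then have "h + 1 = b k" using less.prems by simp
    then have "\<tau>' = \<gamma> (b k)" by (simp add: \<tau>'_def)
    moreover have "win_min (\<gamma> (b k)) (\<gamma> (b k)) = F (\<gamma> (b k))" by (intro win_min_eqI) auto
    ultimately show ?thesis using False sum win_end[of \<tau>'] \<tau>\<tau>' by (simp add: \<delta>_def D_def)
  qed
  have unf: "sectionC k h \<tau> d = (if \<delta> \<le> 0 then Some (outputC k (\<tau> + d / mt h)) else sectionC k (h + 1) \<tau>' \<delta>)"
    using less.prems by (subst sectionC.simps) (simp add: \<delta>_def \<tau>'_def Let_def)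
  show ?case
  proof (cases "\<delta> \<le> 0")
    case False
    then have D: "D k \<tau>' > 0" using \<delta> by simp
    \<comment> \<open>A positive value rules out the peak, so the loop cannot run out without
      output.\<close>
    then have "\<tau>' \<noteq> \<gamma> (b k)" using D_at_peak[OF k] by auto
    then have "h + 1 \<noteq> b k" by (auto simp: \<tau>'_def)
    then have hb: "h + 1 < b k" using less.prems by simp
    have "finds_jump k \<tau>' (sectionC k (h + 1) \<tau>' \<delta>)"
      using less.prems hb g D \<delta> \<tau>\<tau>' bM gamma_less[of "h + 1" "h + 1 + 1"]
      by (intro less.hyps) (auto simp: \<tau>'_def)
    then have "finds_jump k \<tau> (sectionC k (h + 1) \<tau>' \<delta>)"
      using less.prems \<tau>\<tau>' \<tau>'b D by (intro finds_jump_step[OF k, of \<tau> \<tau>']) auto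
    then show ?thesis using unf False by simp
  next
    case True
    then have D': "F c \<le> win_min \<tau>' (\<gamma> (b k))" using \<delta> win_end[of \<tau>'] \<tau>\<tau>' by (simp add: D_def)
    have aff: "F s = F \<tau> + mt h * (s - \<tau>)" if "\<tau> \<le> s" "s \<le> \<tau>'" for s
    proof -
      have "gam h \<le> ereal s" using less.prems that by (meson ereal_less_eq(3) order_trans)
      then have "F s - F \<tau> = mt h * (s - \<tau>)"
        using less.prems that g \<tau>\<tau>' bM by (intro F_affine) auto
      then show ?thesis by simp
    qed
    have win_min: "win_min s (\<gamma> (b k)) = min (F s) (win_min \<tau>' (\<gamma> (b k)))" if "\<tau> \<le> s" "s \<le> \<tau>'" for s
    proof -
      have "gam h \<le> ereal s" using less.prems that by (meson ereal_less_eq(3) order_trans)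
      then have "win_min s \<tau>' = min (F s) (F \<tau>')"
        using less.prems that g bM by (intro win_min_segment[of h]) auto
      moreover have "win_min \<tau>' (\<gamma> (b k)) \<le> F \<tau>'" using \<tau>'b by (intro win_min_le) auto
      ultimately show ?thesis using win_min_split[of s \<tau>' "\<gamma> (b k)"] that \<tau>'b by simp
    qed
    \<comment> \<open>From \<open>\<tau>'\<close> up to the peak \<open>F\<close> is at least
      \<open>F c\<close>, yet \<open>d > 0\<close>; hence the minimum is attained at the left end
      \<open>\<tau>\<close> itself.\<close>
    have d: "d = F c - F \<tau>" using less.prems win_min[of \<tau>] D' win_end[of \<tau>] \<tau>\<tau>' by (auto simp: D_def min_def split: if_splits)
    have "F c \<le> F \<tau>'" using D' win_min_le[of \<tau>' \<tau>' "\<gamma> (b k)"] \<tau>'b by simp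
    then have dm: "d \<le> mt h * (\<tau>' - \<tau>)" using d aff[of \<tau>'] \<tau>\<tau>' by simp
    then have m: "mt h > 0" using less.prems \<tau>\<tau>' by (smt (verit) mult_nonneg_nonneg mult_nonpos_nonneg)
    \<comment> \<open>The solution of \<open>F \<tau> + mt h * (\<sigma> - \<tau>) = F c\<close>:
      here the rising left end reaches the height of the local minimum.\<close>
    define \<sigma> where "\<sigma> = \<tau> + d / mt h"
    have \<sigma>: "\<tau> < \<sigma>" "\<sigma> \<le> \<tau>'" using m less.prems dm by (auto simp: \<sigma>_def field_simps)
    have "F \<sigma> = F c" using aff[of \<sigma>] \<sigma> d m by (simp add: \<sigma>_def)
    then have "D k \<sigma> \<le> 0" using win_min[of \<sigma>] D' \<sigma> win_end[of \<sigma>] by (simp add: D_def)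
    moreover have "D k s > 0" if "\<tau> \<le> s" "s < \<sigma>" for s
    proof -
      have "F s < F \<sigma>" using aff[of s] aff[of \<sigma>] that \<sigma> m by simp
      then show ?thesis using win_min[of s] win_end[of s] that \<sigma> \<open>F \<sigma> = F c\<close> by (simp add: D_def)
    qed
    moreover have "outputC k \<sigma> = (if feasible k \<sigma> then ereal (\<sigma> - x\<^sub>1) else \<infinity>)"
      using less.prems \<sigma> by (intro outputC_eq[OF k A]) auto
    ultimately show ?thesis using unf True \<sigma> \<tau>'b unfolding finds_jump_def
      by (intro exI[of _ \<sigma>]) (auto simp: \<sigma>_def)
  qed
qed

text \<open>\<open>\<phi>\<close> is a formula for \<open>D k\<close> that is valid on
  \<open>[0, \<psi>]\<close> but defined everywhere. The signs of \<open>D k\<close> at the two ends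
  force its zero \<open>e\<close> into that interval, so the branches of \<open>outputB\<close> need
  no separate range check.\<close>

lemma strict_crossing:
  fixes \<phi> :: "real \<Rightarrow> real"
  assumes anti: "\<And>x y. x < y \<Longrightarrow> \<phi> y < \<phi> x"
    and eq: "\<And>u. 0 \<le> u \<Longrightarrow> u \<le> \<psi> \<Longrightarrow> D k (\<tau> + u) = \<phi> u"
    and "0 \<le> \<psi>" "0 \<le> D k \<tau>" "D k (\<tau> + \<psi>) \<le> 0" "\<phi> e = 0"
  shows "0 \<le> e \<and> e \<le> \<psi> \<and> D k (\<tau> + e) = 0 \<and> (\<forall>s. \<tau> \<le> s \<and> s < \<tau> + e \<longrightarrow> D k s > 0)"
proof -
  have "\<phi> 0 \<ge> 0" "\<phi> \<psi> \<le> 0" using eq[of 0] eq[of \<psi>] assms by auto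
  then have e: "0 \<le> e" "e \<le> \<psi>" using anti[of e 0] anti[of \<psi> e] assms(6) by (auto simp: not_le[symmetric])
  have "D k s > 0" if "\<tau> \<le> s" "s < \<tau> + e" for s
    using eq[of "s - \<tau>"] anti[of "s - \<tau>" e] that e assms(6) by simp
  then show ?thesis using e eq[of e] assms(6) by simp
qed

text \<open>This is why the algorithm only compares the left end of the window with the values \<open>\<chi>\<^sub>q\<close>.\<close>

lemma F_left_lower_bound:
  assumes k: "1 \<le> k" "k \<le> nB" and h: "h < b k" "gam h \<le> ereal s"
    and y: "s \<le> y" "y \<le> \<gamma> (b k)"
  shows "F s \<le> F y \<or> (\<exists>q\<in>{1..k}. h < ai q \<and> F (\<gamma> (ai q)) \<le> F y)"
proof -
  \<comment> \<open>This selects the stretch between consecutive local maxima that contains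
    \<open>y\<close>. At \<open>y = \<gamma> (b k)\<close> the choice of \<open>exists_bi\<close>
    would be \<open>n = k\<close>, so the preceding stretch is taken.\<close>
  have "\<exists>n<k. gam (bi n) \<le> ereal y \<and> ereal y \<le> gam (bi (n + 1))"
  proof (cases "y = \<gamma> (b k)")
    case True
    obtain n where n: "k = n + 1" using k(1) by (metis le_add_diff_inverse2)
    then have "gam (bi n) \<le> gam (bi k)" using bi_mono[of n k] k by (intro gam_mono) simp
    then show ?thesis using True n k by (intro exI[of _ n]) (auto simp: gam_bi)
  next
    case False
    obtain n where n: "n \<le> nB" "gam (bi n) \<le> ereal y" "ereal y < gam (bi (n + 1))"
      using exists_bi by blast
    have "gam (bi n) < gam (bi k)" using n(2) False y k by (simp add: gam_bi le_less_trans)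
    then have "bi n < bi k" using gam_less_iff bi_le by blast
    then have "n < k" using bi_mono[of k n] k by (cases n k rule: linorder_cases) auto
    then show ?thesis using n by (auto intro: less_imp_le)
  qed
  then obtain n where n: "n < k" "gam (bi n) \<le> ereal y" "ereal y \<le> gam (bi (n + 1))" by blast
  have nA: "n + 1 \<le> nA" using n(1) k nB_le_nA by simp
  have am: "ai (n + 1) \<le> M" using ai_less_bi[of "n + 1"] nA bi_le[of "n + 1"] by simp
  have ga: "gam (ai (n + 1)) = ereal (\<gamma> (ai (n + 1)))"
    using am ai_pos[of "n + 1"] by (intro gam_eq) auto
  have up: "F x \<le> F y" if "gam (ai (n + 1)) \<le> ereal x" "x \<le> y" for x
    using F_increasing[OF that n(3)] .
  show ?thesis
  \<comment> \<open>Either the local minimum of this stretch lies to the right of segment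
    \<open>h\<close> and bounds \<open>F y\<close> from below, or \<open>s\<close> is already beyond
    it and \<open>F\<close> is nondecreasing from \<open>s\<close> to \<open>y\<close>.\<close>
  proof (cases "h < ai (n + 1)")
    case True
    have "F (\<gamma> (ai (n + 1))) \<le> F y"
    proof (cases "y < \<gamma> (ai (n + 1))")
      case True
      then show ?thesis using F_decreasing[of n y "\<gamma> (ai (n + 1))"] n ga by simp
    next
      case False
      then show ?thesis using up[of "\<gamma> (ai (n + 1))"] ga by simp
    qed
    then show ?thesis using True n(1) by (intro disjI2 bexI[of _ "n + 1"]) auto
  next
    case False
    then have "gam (ai (n + 1)) \<le> ereal s" using h(2) gam_mono[of "ai (n + 1)" h] by simp
    then show ?thesis using up y by blast
  qed
qed

text \<open>Between \<open>\<tau>\<close> and \<open>\<tau>'\<close> the window ends stay in the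
  segments \<open>h\<close> and \<open>i\<close>. The value at the right end is linear with slope
  \<open>mt i < 0\<close>; the minimum on the left is the value at the left end or, if smaller, the
  lowest local minimum ahead, at height \<open>m\<close> relative to \<open>F \<tau>\<close>. The
  branches of \<open>outputB\<close> solve \<open>D k = 0\<close> for the possible shapes.\<close>

lemma outputB_correct:
  assumes k: "1 \<le> k" "k \<le> nB"
    and h: "h < b k" "gam h \<le> ereal \<tau>" "ereal \<tau>' \<le> gam (h + 1)"
    and i: "b k \<le> i" "i < ai (k + 1)" "gam i \<le> ereal (\<tau> + len)" "ereal (\<tau>' + len) \<le> gam (i + 1)"
    and \<tau>: "\<tau> < \<tau>'" "\<gamma> (b k) - len \<le> \<tau>"
    and D: "D k \<tau> \<ge> 0" "D k \<tau>' \<le> 0"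
  shows "finds_jump k \<tau> (Some (ereal (outputB k h i \<tau> (D k \<tau>))))"
proof -
  define g where "g = \<gamma> (h + 1)"
  have bM: "b k \<le> M" using b_range k by auto
  have hM: "h \<le> M" using h bM by simp
  have gg: "gam (h + 1) = ereal g" using h bM unfolding g_def by (intro gam_eq) auto
  have \<tau>'g: "\<tau>' \<le> g" using h(3) gg by simp
  have gb: "g \<le> \<gamma> (b k)" unfolding g_def using gamma_less[of "h + 1" "b k"] h bM by (cases "h + 1 = b k") auto
  have iM: "i \<le> M" using i(2) ai_le[of "k + 1"] by simp
  have mi: "mt i < 0" using i k by (intro mt_neg[of k]) (auto simp: bi_def)
  have Fs: "F s = F \<tau> + mt h * (s - \<tau>)" if "\<tau> \<le> s" "s \<le> g" for s
  proof -
    have "ereal \<tau> \<le> ereal s" using that by simp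
    then have "gam h \<le> ereal s" using h(2) by (rule order_trans[rotated])
    then have "F s - F \<tau> = mt h * (s - \<tau>)" using h gg that hM by (intro F_affine) auto
    then show ?thesis by simp
  qed
  have win_end: "win_end k s = s + len" if "s \<le> \<tau>'" for s
  proof -
    have "ereal (s + len) \<le> ereal (\<tau>' + len)" using that by simp
    also have "\<dots> \<le> gam (ai (k + 1))" using i(2) gam_mono[of "i + 1" "ai (k + 1)"] i(4) by simp
    finally show ?thesis using win_end_greatest[of "s + len" s k] win_end_le[of k s] by simp
  qed
  have Ft: "F (s + len) = F (\<tau> + len) + mt i * (s - \<tau>)" if "\<tau> \<le> s" "s \<le> \<tau>'" for s
  proof -
    have "ereal (\<tau> + len) \<le> ereal (s + len)" "ereal (s + len) \<le> ereal (\<tau>' + len)" using that by auto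
    then have "gam i \<le> ereal (s + len)" "ereal (s + len) \<le> gam (i + 1)" "ereal (\<tau> + len) \<le> gam (i + 1)"
      using i by (blast intro: order_trans)+
    then have "F (s + len) - F (\<tau> + len) = mt i * (s + len - (\<tau> + len))"
      using i(3) iM by (intro F_affine) auto
    then show ?thesis by simp
  qed
  have mn_F: "win_min s (\<gamma> (b k)) \<le> F s" if "s \<le> g" for s using that gb by (intro win_min_le) auto
  have Deq: "D k (\<tau> + u) = F (\<tau> + len) + mt i * u - win_min (\<tau> + u) (\<gamma> (b k))" if "0 \<le> u" "u \<le> \<tau>' - \<tau>" for u
    using Ft[of "\<tau> + u"] win_end[of "\<tau> + u"] that by (simp add: D_def)
  define r where "r = (THE r. 1 \<le> r \<and> r \<le> k + 1 \<and> aa k (r - 1) \<le> h \<and> h < aa k r)"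
  have rk: "countA h \<le> k"
  proof -
    have "countB h < k" using bi_le_iff[of h k] hM h(1) k by (simp add: bi_def not_le[symmetric])
    then show ?thesis using countA_eq_countB[OF hM] by (simp split: if_splits)
  qed
  \<comment> \<open>\<open>r\<close> is the index of the first local minimum to the right of segment
    \<open>h\<close>; \<open>r > k\<close> means that there is none before the peak.\<close>
  have r: "r = countA h + 1"
    unfolding r_def
  proof (rule the_equality)
    show "1 \<le> countA h + 1 \<and> countA h + 1 \<le> k + 1 \<and> aa k (countA h + 1 - 1) \<le> h \<and> h < aa k (countA h + 1)"
      using rk k ai_le_iff[OF hM, of "countA h"] ai_le_iff[OF hM, of "countA h + 1"] by (auto simp: aa_eq not_le[symmetric])
    fix r assume "1 \<le> r \<and> r \<le> k + 1 \<and> aa k (r - 1) \<le> h \<and> h < aa k r"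
    then show "r = countA h + 1"
      using k ai_le_iff[OF hM, of "r - 1"] ai_le_iff[OF hM, of r] by (auto simp: aa_eq not_le[symmetric])
  qed
  have h_less: "h < ai q \<longleftrightarrow> r \<le> q" for q using ai_le_iff[OF hM, of q] r by auto
  define chi where "chi = (\<lambda>q. mt h * (\<gamma> (h + 1) - \<tau>) + (\<Sum>p = h + 1..<aa k q. seg p))"
  have chi: "chi q = F (\<gamma> (ai q)) - F \<tau> \<and> g \<le> \<gamma> (ai q) \<and> \<gamma> (ai q) \<le> \<gamma> (b k)" if q: "r \<le> q" "q \<le> k" for q
  proof -
    have q1: "1 \<le> q" using q r by simp
    have "h < ai q" using h_less q by simp
    moreover have "ai q < bi q" using q q1 k nB_le_nA by (intro ai_less_bi) auto
    moreover have "bi q \<le> bi k" using bi_mono[of q k] q k by (cases "q = k") auto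
    ultimately have o: "h + 1 \<le> ai q" "ai q < b k" using k by (auto simp: bi_def)
    then have "(\<Sum>p = h + 1..<ai q. seg p) = F (\<gamma> (ai q)) - F g"
      using sum_seg[of "h + 1" "ai q"] bM by (simp add: g_def)
    moreover have "mt h * (g - \<tau>) = F g - F \<tau>" using Fs[of g] \<tau> \<tau>'g by simp
    moreover have "g \<le> \<gamma> (ai q)" using gamma_less[of "h + 1" "ai q"] o bM unfolding g_def
      by (cases "h + 1 = ai q") auto
    moreover have "\<gamma> (ai q) \<le> \<gamma> (b k)" using gamma_less[of "ai q" "b k"] o bM by simp
    ultimately show ?thesis using q k by (simp add: chi_def aa_eq g_def)
  qed
  define m where "m = Min (chi ` {r..k})"
  have m_le: "m \<le> chi q" if "r \<le> q" "q \<le> k" for q unfolding m_def using that by (intro Min_le) auto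
  have m_ex: "\<exists>q. r \<le> q \<and> q \<le> k \<and> m = chi q" if "r \<le> k"
  proof -
    have "m \<in> chi ` {r..k}" unfolding m_def using that by (intro Min_in) auto
    then show ?thesis by auto
  qed
  have win_min_r: "win_min s (\<gamma> (b k)) = min (F s) (F \<tau> + m)" if s: "\<tau> \<le> s" "s \<le> g" and "r \<le> k" for s
  proof (rule antisym)
    obtain q where q: "r \<le> q" "q \<le> k" "m = chi q" using m_ex \<open>r \<le> k\<close> by blast
    have "win_min s (\<gamma> (b k)) \<le> F (\<gamma> (ai q))" using chi[OF q(1,2)] s by (intro win_min_le) auto
    then show "win_min s (\<gamma> (b k)) \<le> min (F s) (F \<tau> + m)" using mn_F s chi[OF q(1,2)] q(3) by simp
    show "min (F s) (F \<tau> + m) \<le> win_min s (\<gamma> (b k))"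
    proof (rule le_mn)
      fix y assume y: "s \<le> y" "y \<le> \<gamma> (b k)"
      have "ereal \<tau> \<le> ereal s" using s by simp
      then have "gam h \<le> ereal s" using h(2) by (rule order_trans[rotated])
      from F_left_lower_bound[OF k h(1) this y]
      show "min (F s) (F \<tau> + m) \<le> F y"
      proof (elim disjE bexE conjE)
        fix q assume q: "q \<in> {1..k}" "h < ai q" "F (\<gamma> (ai q)) \<le> F y"
        then show ?thesis using h_less[of q] m_le[of q] chi[of q] by (simp add: min_le_iff_disj)
      qed simp
    qed (use s gb in simp)
  qed
  have win_min_no: "win_min s (\<gamma> (b k)) = F s" if s: "\<tau> \<le> s" "s \<le> g" and "\<not> r \<le> k" for s
  proof (rule win_min_eqI)
    fix y assume y: "s \<le> y" "y \<le> \<gamma> (b k)"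
    have "ereal \<tau> \<le> ereal s" using s by simp
    then have "gam h \<le> ereal s" using h(2) by (rule order_trans[rotated])
    from F_left_lower_bound[OF k h(1) this y]
    show "F s \<le> F y" using h_less \<open>\<not> r \<le> k\<close> by auto
  qed (use s gb in auto)
  \<comment> \<open>With a negative slope the left end is on a decreasing stretch that ends in a
    local minimum before the peak. So \<open>mt h\<close> is nonnegative whenever
    \<open>r > k\<close> or \<open>m > 0\<close>.\<close>
  have neg: "r \<le> k \<and> m \<le> mt h * (g - \<tau>) \<and> m < 0" if "mt h < 0"
  proof -
    have "countB h = countA h" using countA_eq_countB[OF hM] that by (simp add: mt_def)
    moreover have "countB h < k" using bi_le_iff[of h k] hM h(1) k by (simp add: bi_def not_le[symmetric])
    ultimately have rk: "r \<le> k" using r by simp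
    have "bi (countA h) \<le> h" using bi_le_iff[OF hM, of "countA h"] \<open>countB h = countA h\<close> by simp
    then have "gam (bi (countA h)) \<le> ereal g" using gam_mono[of "bi (countA h)" "h + 1"] gg by simp
    moreover have "ai r \<le> M"
      using chi[of r] rk ai_less_bi[of r] bi_le[of r] r k nB_le_nA by simp
    then have ga: "gam (ai r) = ereal (\<gamma> (ai r))" using ai_pos[of r] r by (intro gam_eq) auto
    ultimately have "F (\<gamma> (ai r)) \<le> F g"
      using F_decreasing[of "countA h" g "\<gamma> (ai r)"] chi[of r] rk r by (cases "g = \<gamma> (ai r)") auto
    then have "m \<le> F g - F \<tau>" using m_le[of r] chi[of r] rk by simp
    also have "\<dots> = mt h * (g - \<tau>)" using Fs[of g] \<tau> \<tau>'g by simp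
    finally have "m \<le> mt h * (g - \<tau>)" .
    moreover have "mt h * (g - \<tau>) < 0" using that \<tau> \<tau>'g by (intro mult_neg_pos) auto
    ultimately show ?thesis using rk by simp
  qed
  define d where "d = D k \<tau>"
  define \<psi> where "\<psi> = \<tau>' - \<tau>"
  have \<psi>: "0 \<le> \<psi>" "0 \<le> D k \<tau>" "D k (\<tau> + \<psi>) \<le> 0" "\<And>u. u \<le> \<psi> \<Longrightarrow> \<tau> + u \<le> g" using D \<tau> \<tau>'g by (auto simp: \<psi>_def)
  have out: "outputB k h i \<tau> d = (if r \<le> k then
      if m \<le> 0 then \<tau> - x\<^sub>1 - d / mt i
      else if ereal (- ((d - m) / mt i)) \<le> ereal m / ereal (mt h)
        then \<tau> - x\<^sub>1 + d / (mt h - mt i) else \<tau> - x\<^sub>1 - (d - m) / mt i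
      else \<tau> - x\<^sub>1 + d / (mt h - mt i))"
    unfolding outputB_def Let_def r_def[symmetric] chi_def[symmetric] m_def[symmetric] by simp
  have d0: "d = F (\<tau> + len) - win_min \<tau> (\<gamma> (b k))" using Deq[of 0] \<tau> by (simp add: d_def)
  have "\<exists>e \<phi>. outputB k h i \<tau> d = \<tau> + e - x\<^sub>1 \<and> \<phi> e = 0 \<and> (\<forall>x y. x < y \<longrightarrow> \<phi> y < \<phi> x)
    \<and> (\<forall>u. 0 \<le> u \<and> u \<le> \<psi> \<longrightarrow> D k (\<tau> + u) = \<phi> u)"
  proof (cases "r \<le> k")
    case False
    then have mh: "mt h \<ge> 0" using neg by force
    define \<phi> where "\<phi> u = d + mt i * u - mt h * u" for u
    have "\<phi> (d / (mt h - mt i)) = 0" using mh mi by (simp add: \<phi>_def field_simps)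
    moreover have "\<phi> y < \<phi> x" if "x < y" for x y
    proof -
      have "mt i * y < mt i * x" "mt h * x \<le> mt h * y" using mi mh that by (auto intro: mult_left_mono)
      then show ?thesis by (simp add: \<phi>_def)
    qed
    moreover have "D k (\<tau> + u) = \<phi> u" if "0 \<le> u" "u \<le> \<psi>" for u
      using Deq[of u] win_min_no[of "\<tau> + u"] win_min_no[of \<tau>] Fs[of "\<tau> + u"] \<psi>(4)[of u] \<psi>(4)[of 0] \<psi>(1) d0 False that
      by (simp add: \<phi>_def \<psi>_def)
    ultimately show ?thesis using out False by (intro exI[of _ "d / (mt h - mt i)"] exI[of _ \<phi>]) auto
  next
    case rk: True
    show ?thesis
    proof (cases "m \<le> 0")
      case True
      define \<phi> where "\<phi> u = d + mt i * u" for u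
      have "\<phi> (- d / mt i) = 0" using mi by (simp add: \<phi>_def)
      moreover have "\<phi> y < \<phi> x" if "x < y" for x y using mi that by (simp add: \<phi>_def)
      moreover have "D k (\<tau> + u) = \<phi> u" if u: "0 \<le> u" "u \<le> \<psi>" for u
      proof -
        \<comment> \<open>The left end never drops below the lowest local minimum, so the minimum
          stays constant and only the right end matters.\<close>
        have "m \<le> mt h * u"
        proof (cases "mt h < 0")
          case True
          have "mt h * (g - \<tau>) \<le> mt h * u" using True \<psi>(4)[OF u(2)] by (intro mult_left_mono_neg) auto
          moreover have "m \<le> mt h * (g - \<tau>)" using neg True by blast
          ultimately show ?thesis by linarith
        next
          case False
          then have "0 \<le> mt h * u" using u by simp
          then show ?thesis using \<open>m \<le> 0\<close> by simp
        qed
        then have "win_min (\<tau> + u) (\<gamma> (b k)) = F \<tau> + m"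
          using win_min_r[of "\<tau> + u"] Fs[of "\<tau> + u"] \<psi>(4)[OF u(2)] u rk by simp
        moreover have "win_min \<tau> (\<gamma> (b k)) = F \<tau> + m" using win_min_r[of \<tau>] True rk \<psi>(4)[of 0] \<psi>(1) by simp
        ultimately show ?thesis using Deq[of u] d0 u by (simp add: \<phi>_def \<psi>_def)
      qed
      ultimately show ?thesis using out rk True by (intro exI[of _ "- d / mt i"] exI[of _ \<phi>]) auto
    next
      case m: False
      then have mh: "mt h \<ge> 0" using neg by force
      define \<phi> where "\<phi> u = d + mt i * u - min (mt h * u) m" for u
      \<comment> \<open>The root with the minimum frozen at \<open>m\<close> is compared with the
        kink \<open>m / mt h\<close>, where the left end climbs to that height. If it is not beyond
        the kink, \<open>\<phi>\<close> vanishes where the minimum is still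
        \<open>mt h * u\<close>.\<close>
      define e where "e = (if ereal (- ((d - m) / mt i)) \<le> ereal m / ereal (mt h)
        then d / (mt h - mt i) else - ((d - m) / mt i))"
      have "\<phi> e = 0"
      proof (cases "ereal (- ((d - m) / mt i)) \<le> ereal m / ereal (mt h)")
        case True
        have "mt h * (d / (mt h - mt i)) \<le> m"
        proof (cases "mt h = 0")
          case False
          then have mp: "mt h > 0" using mh by simp
          then have "- ((d - m) / mt i) \<le> m / mt h" using True by simp
          then have "(d - m) / (- mt i) \<le> m / mt h" by simp
          then have "(d - m) * mt h \<le> m * (- mt i)" using mp mi by (simp only: divide_le_eq less_divide_eq) (simp add: field_simps)
          then show ?thesis using mp mi by (simp add: field_simps)
        qed (use m in simp)
        then have "\<phi> e = d + mt i * (d / (mt h - mt i)) - mt h * (d / (mt h - mt i))" using True by (simp add: \<phi>_def e_def)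
        also have "\<dots> = 0" using mh mi by (simp add: field_simps)
        finally show ?thesis .
      next
        case False
        have mp: "mt h > 0"
        proof (rule ccontr)
          assume "\<not> mt h > 0"
          then have "mt h = 0" using mh by simp
          \<comment> \<open>For \<open>mt h = 0\<close> the quotient of the positive
            \<open>m\<close> is infinite in \<open>ereal\<close>, so the test could not have
            failed.\<close>
          then show False using False m by (simp add: divide_ereal_def)
        qed
        then have "m / mt h < - ((d - m) / mt i)" using False by simp
        then have "m \<le> mt h * (- ((d - m) / mt i))" using mp by (simp add: divide_less_eq mult.commute)
        then show ?thesis using False mi by (simp add: \<phi>_def e_def)
      qed
      moreover have "\<phi> y < \<phi> x" if "x < y" for x y
      proof -
        have "mt i * y < mt i * x" "mt h * x \<le> mt h * y" using mi mh that by (auto intro: mult_left_mono)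
        then show ?thesis by (simp add: \<phi>_def)
      qed
      moreover have "D k (\<tau> + u) = \<phi> u" if u: "0 \<le> u" "u \<le> \<psi>" for u
      proof -
        have "win_min (\<tau> + u) (\<gamma> (b k)) = F \<tau> + min (mt h * u) m"
          using win_min_r[of "\<tau> + u"] Fs[of "\<tau> + u"] \<psi>(4)[OF u(2)] u rk by (simp add: min_def)
        moreover have "win_min \<tau> (\<gamma> (b k)) = F \<tau>" using win_min_r[of \<tau>] m rk \<psi>(4)[of 0] \<psi>(1) by simp
        ultimately show ?thesis using Deq[of u] d0 u by (simp add: \<phi>_def \<psi>_def)
      qed
      ultimately show ?thesis using out rk m by (intro exI[of _ e] exI[of _ \<phi>]) (auto simp: e_def)
    qed
  qed
  then obtain e \<phi> where e: "outputB k h i \<tau> d = \<tau> + e - x\<^sub>1" "\<phi> e = 0" "\<And>x y. x < y \<Longrightarrow> \<phi> y < (\<phi> x :: real)"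
    "\<And>u. 0 \<le> u \<Longrightarrow> u \<le> \<psi> \<Longrightarrow> D k (\<tau> + u) = \<phi> u" by blast
  have cr: "0 \<le> e \<and> e \<le> \<psi> \<and> D k (\<tau> + e) = 0 \<and> (\<forall>s. \<tau> \<le> s \<and> s < \<tau> + e \<longrightarrow> D k s > 0)"
    using strict_crossing[of \<phi> \<psi> k \<tau> e, OF e(3,4) \<psi>(1-3) e(2)] by blast
  \<comment> \<open>The right end has not gone beyond \<open>ai (k + 1)\<close>, so
    \<open>feasible\<close> concerns just this end point.\<close>
  moreover have "feasible k (\<tau> + e)"
    unfolding feasible_def using win_end[of "\<tau> + e"] cr by (auto simp: \<psi>_def)
  ultimately show ?thesis unfolding finds_jump_def
    using e(1) gb \<psi>(4)[of e] by (intro exI[of _ "\<tau> + e"]) (auto simp: d_def)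
qed

text \<open>Loop invariant: \<open>h\<close> and \<open>i\<close> are the segments of the two window
  ends and \<open>d\<close> is \<open>D k\<close> at the left one; each round advances
  \<open>h\<close> or \<open>i\<close>. Section C needs \<open>d > 0\<close>, whereas
  \<open>d = 0\<close> is allowed at the start; hence the last hypothesis, which concerns the
  handover.\<close>

lemma sectionB_correct:
  assumes k: "1 \<le> k" "k \<le> nB"
    and "h < b k" "gam h \<le> ereal \<tau>" "ereal \<tau> < gam (h + 1)"
    and "b k \<le> i" "i \<le> ai (k + 1)" "gam i \<le> ereal \<theta>" "ereal \<theta> < gam (i + 1)" "\<theta> = \<tau> + len"
    and "\<gamma> (b k) - len \<le> \<tau>" "d = D k \<tau>" "d \<ge> 0" "i = ai (k + 1) \<Longrightarrow> d > 0"
  shows "finds_jump k \<tau> (sectionB k h i \<tau> \<theta> d)"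
  using assms(3-)
proof (induction "(b k - h) + (ai (k + 1) - i)" arbitrary: h i \<tau> \<theta> d rule: less_induct)
  case less
  note prems = less.prems
  have aak: "aa k (k + 1) = ai (k + 1)" using k by (simp add: aa_eq)
  have bM: "1 \<le> b k" "b k \<le> M" using b_range k by auto
  show ?case
  proof (cases "i < ai (k + 1)")
    case False
    then have ia: "i = ai (k + 1)" "d > 0" using prems by auto
    have iM: "ai (k + 1) \<le> M"
    proof (rule ccontr)
      assume "\<not> ?thesis"
      then show False using ia(1) prems(6) gam_top[of i] by simp
    qed
    then have "gam i = ereal (\<gamma> (ai (k + 1)))" using ia ai_pos[of "k + 1"] gam_eq[of i] by simp
    moreover have "gam (h + 1) = ereal (\<gamma> (h + 1))" using prems(1) bM by (intro gam_eq) auto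
    ultimately have "finds_jump k \<tau> (sectionC k h \<tau> d)"
      using prems ia by (intro sectionC_correct[OF k iM]) auto
    moreover have "sectionB k h i \<tau> \<theta> d = sectionC k h \<tau> d"
      using False unfolding sectionB.simps[of k h i] aak by simp
    ultimately show ?thesis by simp
  next
    case True
    have iM: "i \<le> M" using True ai_le[of "k + 1"] by simp
    have gh: "gam (h + 1) = ereal (\<gamma> (h + 1))" using prems(1) bM by (intro gam_eq) auto
    define u where "u = gam (h + 1) - ereal \<tau>"
    define v where "v = gam (i + 1) - ereal \<theta>"
    define \<psi> where "\<psi> = real_of_ereal (min u v)"
    define n where "n = (if u \<le> v then h + 1 else h)"
    define \<xi> where "\<xi> = (if u \<ge> v then i + 1 else i)"
    define \<tau>' where "\<tau>' = \<tau> + \<psi>"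
    define \<theta>' where "\<theta>' = \<theta> + \<psi>"
    define \<delta> where "\<delta> = pos_part_iter k n \<tau>' + (if \<xi> = b k then mt \<xi> * (\<theta>' - \<gamma> \<xi>)
       else if \<xi> = aa k (k + 1) then (\<Sum>p = b k..<\<xi>. seg p)
       else (\<Sum>p = b k..<\<xi>. seg p) + mt \<xi> * (\<theta>' - \<gamma> \<xi>))"
    have uv: "u = ereal (\<gamma> (h + 1) - \<tau>)" "u > 0" "v > 0" "v \<noteq> -\<infinity>"
      using gh prems(3,7) unfolding u_def v_def by (cases "gam (i + 1)"; auto)+
    have e\<psi>: "ereal \<psi> = min u v" unfolding \<psi>_def
      using uv by (intro ereal_real') (cases v; auto simp: min_def)
    have "ereal \<psi> > 0" unfolding e\<psi> using uv by simp
    then have \<psi>0: "\<psi> > 0" by simp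
    have \<psi>le: "ereal \<psi> \<le> u" "ereal \<psi> \<le> v" unfolding e\<psi> by auto
    have \<tau>': "\<tau> < \<tau>'" "ereal \<tau>' \<le> gam (h + 1)" using \<psi>0 \<psi>le(1) uv(1) gh by (auto simp: \<tau>'_def)
    have \<theta>': "\<theta> < \<theta>'" "ereal \<theta>' \<le> gam (i + 1)" "\<theta>' = \<tau>' + len"
      using \<psi>0 \<psi>le(2) prems(8) unfolding v_def by (cases "gam (i + 1)"; auto simp: \<theta>'_def \<tau>'_def)+
    have n: "gam n \<le> ereal \<tau>'" "ereal \<tau>' < gam (n + 1)" "n \<le> b k" "h \<le> n" "h < n \<or> i < \<xi>"
    proof -
      have "ereal \<tau> \<le> ereal \<tau>'" using \<tau>' by simp
      then have 1: "gam h \<le> ereal \<tau>'" using prems(2) by (rule order_trans[rotated])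
      have 2: "ereal \<tau>' = gam (h + 1)" if "u \<le> v"
      proof -
        have "ereal \<psi> = u" using e\<psi> that by (simp add: min_def)
        then show ?thesis using uv(1) gh by (simp add: \<tau>'_def)
      qed
      have 3: "ereal \<tau>' < gam (h + 1)" if "\<not> u \<le> v"
      proof -
        have "ereal \<psi> < u" using e\<psi> that by (simp add: min_def)
        then show ?thesis using uv(1) gh by (simp add: \<tau>'_def)
      qed
      show "gam n \<le> ereal \<tau>'" "ereal \<tau>' < gam (n + 1)" using 1 2 3 prems(1) bM gam_less[of "h + 1" "h + 1 + 1"]
        by (auto simp: n_def)
      show "n \<le> b k" "h \<le> n" "h < n \<or> i < \<xi>" using prems(1) by (auto simp: n_def \<xi>_def)
    qed
    have \<xi>: "gam \<xi> \<le> ereal \<theta>'" "ereal \<theta>' < gam (\<xi> + 1)" "i \<le> \<xi>" "\<xi> \<le> ai (k + 1)" "\<xi> \<le> M"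
      "\<xi> = i + 1 \<Longrightarrow> gam \<xi> = ereal \<theta>'"
    proof -
      have "ereal \<theta> \<le> ereal \<theta>'" using \<theta>' by simp
      then have 1: "gam i \<le> ereal \<theta>'" using prems(6) by (rule order_trans[rotated])
      have 2: "ereal \<theta>' = gam (i + 1)" if "v \<le> u"
      proof -
        have "ereal \<psi> = v" using e\<psi> that by (simp add: min_def)
        then show ?thesis unfolding v_def by (cases "gam (i + 1)") (auto simp: \<theta>'_def)
      qed
      have 3: "ereal \<theta>' < gam (i + 1)" if "\<not> v \<le> u"
      proof -
        have "ereal \<psi> < v" using e\<psi> that by (auto simp: min_def not_le)
        then show ?thesis unfolding v_def by (cases "gam (i + 1)") (auto simp: \<theta>'_def)
      qed
      \<comment> \<open>A breakpoint reached after the finite step \<open>\<psi>\<close> is finite,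
        so \<open>\<xi> = M + 1\<close> never occurs.\<close>
      have 4: "i + 1 \<le> M" if "v \<le> u" using 2[OF that] gam_top[of "i + 1"] by (metis PInfty_neq_ereal(2) not_less)
      show "gam \<xi> \<le> ereal \<theta>'" using 1 2 by (auto simp: \<xi>_def)
      show "ereal \<theta>' < gam (\<xi> + 1)" using 2 3 4 gam_less[of "i + 1" "i + 1 + 1"] by (auto simp: \<xi>_def)
      show "i \<le> \<xi>" "\<xi> \<le> ai (k + 1)" "\<xi> \<le> M" using True iM 4 by (auto simp: \<xi>_def)
      show "gam \<xi> = ereal \<theta>'" if "\<xi> = i + 1" using 2 that by (auto simp: \<xi>_def split: if_splits)
    qed
    have \<tau>'b: "\<tau>' \<le> \<gamma> (b k)" using \<tau>'(2) gh gamma_less[of "h + 1" "b k"] prems(1) bM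
      by (cases "h + 1 = b k") auto
    have win_end: "win_end k \<tau>' = \<theta>'"
    proof -
      have "ereal (\<tau>' + len) \<le> gam (ai (k + 1))"
        using \<theta>' True gam_mono[of "i + 1" "ai (k + 1)"] by (auto intro: order_trans)
      then show ?thesis using win_end_greatest[of "\<tau>' + len" \<tau>' k] win_end_le[of k \<tau>'] \<theta>'(3) by simp
    qed
    have \<delta>: "\<delta> = D k \<tau>'"
    proof -
      have "pos_part_iter k n \<tau>' = F (\<gamma> (b k)) - win_min \<tau>' (\<gamma> (b k))"
        using n \<tau>'b by (intro pos_part_iter_eq[OF k]) auto
      moreover have "(if \<xi> = b k then mt \<xi> * (\<theta>' - \<gamma> \<xi>)
       else if \<xi> = aa k (k + 1) then (\<Sum>p = b k..<\<xi>. seg p)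
       else (\<Sum>p = b k..<\<xi>. seg p) + mt \<xi> * (\<theta>' - \<gamma> \<xi>)) = F \<theta>' - F (\<gamma> (b k))"
      proof -
        have g\<xi>: "gam \<xi> = ereal (\<gamma> \<xi>)" using \<xi>(3,5) prems(4) bM by (intro gam_eq) auto
        have "F \<theta>' - F (\<gamma> \<xi>) = mt \<xi> * (\<theta>' - \<gamma> \<xi>)"
          using \<xi>(1,2,5) g\<xi> gam_mono[of \<xi> "\<xi> + 1"] by (intro F_affine) auto
        moreover have "(\<Sum>p = b k..<\<xi>. seg p) = F (\<gamma> \<xi>) - F (\<gamma> (b k))"
          using \<xi>(3,5) prems(4) bM by (intro sum_seg) auto
        \<comment> \<open>If \<open>\<xi> = ai (k + 1)\<close>, this breakpoint has just been
          reached and the term with \<open>mt \<xi>\<close> would be 0; so all branches give the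
          same difference of \<open>F\<close>.\<close>
        moreover have "\<theta>' = \<gamma> \<xi>" if "\<xi> = ai (k + 1)"
          using that True \<xi>(6) g\<xi> by (auto simp: \<xi>_def split: if_splits)
        ultimately show ?thesis using aak by auto
      qed
      ultimately show ?thesis by (simp add: \<delta>_def D_def win_end)
    qed
    have unf: "sectionB k h i \<tau> \<theta> d = (if \<delta> \<le> 0 then Some (ereal (outputB k h i \<tau> d)) else sectionB k n \<xi> \<tau>' \<theta>' \<delta>)"
      unfolding sectionB.simps[of k h i \<tau> \<theta> d] Let_def u_def[symmetric] v_def[symmetric]
        \<psi>_def[symmetric] \<tau>'_def[symmetric] \<theta>'_def[symmetric] n_def[symmetric] \<xi>_def[symmetric] \<delta>_def[symmetric]
      using prems(1) True aak by simp
    show ?thesis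
    proof (cases "\<delta> \<le> 0")
      case D: True
      have "finds_jump k \<tau> (Some (ereal (outputB k h i \<tau> (D k \<tau>))))"
        using prems \<tau>' \<theta>' True D \<delta> by (intro outputB_correct[OF k, of h \<tau> \<tau>' i]) auto
      then show ?thesis using unf D prems(10) by simp
    next
      case False
      then have D: "D k \<tau>' > 0" using \<delta> by simp
      have nb: "n < b k"
      proof (rule ccontr)
        assume "\<not> n < b k"
        then have "n = b k" using n(3) by simp
        then have "\<gamma> (b k) \<le> \<tau>'" using n(1) bM by (simp add: gam_eq)
        then have "\<tau>' = \<gamma> (b k)" using \<tau>'b by simp
        then show False using D D_at_peak[OF k] by simp
      qed
      have "finds_jump k \<tau>' (sectionB k n \<xi> \<tau>' \<theta>' \<delta>)"
        using n \<xi> nb D \<delta> \<theta>' \<tau>' prems True by (intro less.hyps) auto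
      then have "finds_jump k \<tau> (sectionB k n \<xi> \<tau>' \<theta>' \<delta>)"
        using prems \<tau>' \<tau>'b D by (intro finds_jump_step[OF k, of \<tau> \<tau>']) auto
      then show ?thesis using unf False by simp
    qed
  qed
qed

text \<open>At the start the right end is exactly on the local maximum, so \<open>win_end\<close> is
  \<open>\<gamma> (b k)\<close> and the initial \<open>d\<close> equals \<open>D k \<tau>\<close>,
  which is nonnegative because the minimum on the left takes in that point.\<close>

lemma omega_correct:
  assumes k: "1 \<le> k" "k \<le> nB"
  shows "\<exists>\<sigma>. jump k \<sigma> \<and> \<omega> k = (if feasible k \<sigma> then ereal (\<sigma> - x\<^sub>1) else \<infinity>)"
proof -
  define \<tau> where "\<tau> = \<gamma> (b k) - len"
  define h where "h = (THE h. h \<le> M \<and> gam h \<le> ereal \<tau> \<and> ereal \<tau> < gam (h + 1))"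
  have bM: "1 \<le> b k" "b k \<le> M" using b_range k by auto
  have gb: "gam (b k) = ereal (\<gamma> (b k))" using bM by (simp add: gam_eq)
  have "\<exists>!h. h \<le> M \<and> gam h \<le> ereal \<tau> \<and> ereal \<tau> < gam (h + 1)"
  proof (rule ex_ex1I)
    show "\<exists>n. n \<le> M \<and> gam n \<le> ereal \<tau> \<and> ereal \<tau> < gam (n + 1)" using exists_gam by auto
    fix p q assume pq: "p \<le> M \<and> gam p \<le> ereal \<tau> \<and> ereal \<tau> < gam (p + 1)"
      "q \<le> M \<and> gam q \<le> ereal \<tau> \<and> ereal \<tau> < gam (q + 1)"
    then have "gam p < gam (q + 1)" "gam q < gam (p + 1)" by (metis le_less_trans)+
    then show "p = q" using pq gam_less_iff[of p "q + 1"] gam_less_iff[of q "p + 1"] by simp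
  qed
  from theI'[OF this, folded h_def]
  have h: "h \<le> M" "gam h \<le> ereal \<tau>" "ereal \<tau> < gam (h + 1)" by auto
  have "ereal \<tau> < gam (b k)" using gb len_pos by (simp add: \<tau>_def)
  then have "gam h < gam (b k)" using h(2) by (rule le_less_trans[rotated])
  then have hb: "h < b k" using gam_less_iff[of h "b k"] h(1) bM by simp
  have "ereal (\<tau> + len) \<le> gam (ai (k + 1))"
    using gb gam_mono[of "b k" "ai (k + 1)"] bk_less_ai[OF k] by (simp add: \<tau>_def)
  then have win_end: "win_end k \<tau> = \<gamma> (b k)" using win_end_greatest[of "\<tau> + len" \<tau> k] win_end_le[of k \<tau>] by (simp add: \<tau>_def)
  have pp: "pos_part_iter k h \<tau> = D k \<tau>"
    using pos_part_iter_eq[OF k, of h \<tau>] hb h len_pos win_end by (simp add: D_def \<tau>_def)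
  have "win_min \<tau> (\<gamma> (b k)) \<le> F (\<gamma> (b k))" using len_pos by (intro win_min_le) (auto simp: \<tau>_def)
  then have Dn: "D k \<tau> \<ge> 0" by (simp add: D_def win_end)
  have "finds_jump k \<tau> (sectionB k h (b k) \<tau> (\<gamma> (b k)) (pos_part_iter k h \<tau>))"
    using hb h gb gam_less[of "b k" "b k + 1"] bM bk_less_ai[OF k] Dn pp
    by (intro sectionB_correct[OF k]) (auto simp: \<tau>_def)
  then obtain \<sigma> where \<sigma>: "\<tau> \<le> \<sigma>" "\<sigma> \<le> \<gamma> (b k)" "D k \<sigma> \<le> 0" "\<forall>s. \<tau> \<le> s \<and> s < \<sigma> \<longrightarrow> D k s > 0"
    "sectionB k h (b k) \<tau> (\<gamma> (b k)) (pos_part_iter k h \<tau>) = Some (if feasible k \<sigma> then ereal (\<sigma> - x\<^sub>1) else \<infinity>)"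
    unfolding finds_jump_def by blast
  have "jump k \<sigma>" using \<sigma> by (simp add: jump_def \<tau>_def)
  moreover have "\<omega> k = (if feasible k \<sigma> then ereal (\<sigma> - x\<^sub>1) else \<infinity>)"
    unfolding \<omega>_def Let_def using \<sigma>(5) by (simp add: \<tau>_def len_def h_def)
  ultimately show ?thesis by blast
qed

section \<open>Optimality of the tracked point\<close>

lemma jump_exists: "1 \<le> k \<Longrightarrow> k \<le> nB \<Longrightarrow> \<exists>\<sigma>. jump k \<sigma>"
  using omega_correct by blast

text \<open>The position of the left end of the window at the jump; meaningful only on
  \<open>finite_idx\<close>.\<close>

definition sig :: "nat \<Rightarrow> real" where
  "sig k = real_of_ereal (\<omega> k) + x\<^sub>1"

lemma finite_idxD:
  assumes "k \<in> finite_idx"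
  shows "1 \<le> k" "k \<le> nB" "jump k (sig k)" "feasible k (sig k)" "\<omega> k = ereal (sig k - x\<^sub>1)"
proof -
  show k: "1 \<le> k" "k \<le> nB" using assms by (auto simp: finite_idx_def)
  obtain \<sigma> where \<sigma>: "jump k \<sigma>" "\<omega> k = (if feasible k \<sigma> then ereal (\<sigma> - x\<^sub>1) else \<infinity>)"
    using omega_correct[OF k] by blast
  then have fe: "feasible k \<sigma>" using assms by (auto simp: finite_idx_def split: if_splits)
  then have "sig k = \<sigma>" using \<sigma> by (simp add: sig_def)
  then show "jump k (sig k)" "feasible k (sig k)" "\<omega> k = ereal (sig k - x\<^sub>1)"
    using \<sigma> fe by auto
qed

lemma finite_idxI:
  assumes "1 \<le> k" "k \<le> nB" "jump k \<sigma>" "feasible k \<sigma>"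
  shows "k \<in> finite_idx" "sig k = \<sigma>"
proof -
  obtain \<sigma>' where \<sigma>': "jump k \<sigma>'" "\<omega> k = (if feasible k \<sigma>' then ereal (\<sigma>' - x\<^sub>1) else \<infinity>)"
    using omega_correct[OF assms(1,2)] by blast
  then have "\<sigma>' = \<sigma>" using jump_unique assms by blast
  then have "\<omega> k = ereal (\<sigma> - x\<^sub>1)" using \<sigma>' assms by simp
  then show "k \<in> finite_idx" "sig k = \<sigma>" using assms by (auto simp: finite_idx_def sig_def)
qed

text \<open>Points beyond \<open>\<gamma> (b j)\<close> lie on the decreasing stretch leading down
  to \<open>win_end j s\<close>. Earlier points are covered by \<open>D j s \<le> 0\<close>, which
  persists from the jump on because \<open>D j\<close> does not increase.\<close>

lemma minimal_to_the_left:
  assumes "j \<le> nB" "j = 0 \<or> (\<exists>\<sigma>\<le>s. jump j \<sigma>)" "s \<le> y" "y \<le> win_end j s"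
  shows "F (win_end j s) \<le> F y"
proof (cases "gam (bi j) \<le> ereal y")
  case True
  then show ?thesis using F_decreasing[of j y "win_end j s"] win_end_le_ai[of j s] assms(4)
    by (cases "y = win_end j s") auto
next
  case False
  then have j: "1 \<le> j" by (cases j) (auto simp: bi_def)
  then obtain \<sigma> where \<sigma>: "\<sigma> \<le> s" "jump j \<sigma>" using assms by auto
  have y: "y < \<gamma> (b j)" using False j assms(1) by (simp add: gam_bi)
  then have "D j s \<le> D j \<sigma>" using \<sigma> j assms by (intro D_antimono) (auto simp: jump_def)
  also have "\<dots> \<le> 0" using \<sigma> by (simp add: jump_def)
  finally have "F (win_end j s) \<le> win_min s (\<gamma> (b j))" by (simp add: D_def)
  also have "\<dots> \<le> F y" using assms y by (intro win_min_le) auto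
  finally show ?thesis .
qed

text \<open>If the tracked point is beaten from the right, the leftmost minimiser of the window lies on a
  decreasing stretch of \<open>F\<close>, hence it is the tracked point of a later jump that already occurred.\<close>

lemma later_jump_if_beaten:
  assumes j: "j \<le> nB"
    and left: "\<And>y. s \<le> y \<Longrightarrow> y \<le> max s (win_end j s) \<Longrightarrow> F (max s (win_end j s)) \<le> F y"
    and y: "max s (win_end j s) < y" "y \<le> s + len" "F y < F (max s (win_end j s))"
  shows "\<exists>k\<in>finite_idx. j < k \<and> sig k \<le> s"
proof -
  define p where "p = max s (win_end j s)"
  obtain z where z: "s \<le> z" "z \<le> s + len" "win_min s (s + len) = F z"
    "\<And>y. s \<le> y \<Longrightarrow> y < z \<Longrightarrow> F z < F y"
    using least_minimizer[of s "s + len"] len_pos by auto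
  have zmin: "F z \<le> F w" if "s \<le> w" "w \<le> s + len" for w
    using win_min_le that z(3) by metis
  have "F z < F p" using zmin[of y] y by (auto simp: p_def)
  then have pz: "p < z" using left[of z] z(1) unfolding p_def by (metis not_less)
  have sp: "s \<le> p" by (simp add: p_def)
  obtain k where k: "k \<le> nB" "gam (bi k) \<le> ereal z" "ereal z < gam (bi (k + 1))"
    using exists_bi by blast
  have "win_end j s \<noteq> s + len" using y by (auto simp: p_def)
  then have ai: "gam (ai (j + 1)) \<le> ereal p"
    using win_end_cases[of j s] by (metis ereal_less_eq(3) max.cobounded2 p_def)
  \<comment> \<open>Otherwise \<open>z\<close> would still be on the nondecreasing stretch behind
    \<open>ai (j + 1)\<close>, where nothing beats \<open>p\<close>.\<close>
  have jk: "j < k"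
  proof (rule ccontr)
    assume "\<not> j < k"
    then have "bi (k + 1) \<le> bi (j + 1)" using bi_mono[of "k + 1" "j + 1"] j
      by (cases "k = j") auto
    then have "ereal z \<le> gam (bi (j + 1))" using k(3) gam_mono by (meson less_imp_le order_trans)
    then have "F p \<le> F z" using F_increasing[OF ai] pz by simp
    then show False using \<open>F z < F p\<close> by simp
  qed
  \<comment> \<open>Beyond \<open>ai (k + 1)\<close> a point to the left of \<open>z\<close> would
    be at least as good, against the choice of \<open>z\<close> as leftmost minimiser.\<close>
  have za: "ereal z \<le> gam (ai (k + 1))"
  proof (rule ccontr)
    assume n: "\<not> ereal z \<le> gam (ai (k + 1))"
    then obtain c where c: "gam (ai (k + 1)) = ereal c"
      using gam_ai_neq_MInf[of k] by (cases "gam (ai (k + 1))") auto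
    have "F (max s c) \<le> F z"
      using n c k(3) pz sp by (intro F_increasing[of k]) auto
    moreover have "F z < F (max s c)" using n c pz sp by (intro z(4)) auto
    ultimately show False by simp
  qed
  have zpk: "z = win_end k s"
  proof (rule ccontr)
    assume "z \<noteq> win_end k s"
    then have "z < win_end k s" using win_end_greatest[OF z(2) za] by simp
    then have "F (win_end k s) < F z" using k(2) win_end_le_ai by (intro F_decreasing[of k]) auto
    moreover have "F z \<le> F (win_end k s)" using \<open>z < win_end k s\<close> z(1) win_end_le by (intro zmin) auto
    ultimately show False by simp
  qed
  have k1: "1 \<le> k" using jk by simp
  obtain \<sigma> where \<sigma>: "jump k \<sigma>" using jump_exists[OF k1 k(1)] by blast
  have bz: "\<gamma> (b k) \<le> z" using k(2) k1 k(1) by (simp add: gam_bi)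
  \<comment> \<open>If the peak is not yet behind the left end, minimality of \<open>z\<close> gives
    \<open>D k s \<le> 0\<close>, so the \<open>k\<close>-th jump has occurred by
    \<open>s\<close>.\<close>
  have \<sigma>s: "\<sigma> \<le> s"
  proof (cases "s \<le> \<gamma> (b k)")
    case True
    have "F z \<le> win_min s (\<gamma> (b k))" using True bz z(2) by (intro le_mn zmin) auto
    then have "D k s \<le> 0" by (simp add: D_def zpk)
    then show ?thesis using \<sigma> bz z(2) unfolding jump_def by (meson diff_le_eq not_less order_trans)
  next
    case False
    then show ?thesis using \<sigma> by (auto simp: jump_def)
  qed
  \<comment> \<open>If the window at \<open>\<sigma>\<close> is cut off, its cut-off end is
    \<open>z\<close>, and the points to be compared belong to the window at \<open>s\<close> as
    well.\<close>
  have "feasible k \<sigma>"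
    unfolding feasible_def
  proof (intro allI impI)
    fix y assume y: "win_end k \<sigma> \<le> y \<and> y \<le> \<sigma> + len"
    show "F (win_end k \<sigma>) \<le> F y"
    proof (cases "win_end k \<sigma> = \<sigma> + len")
      case True
      then show ?thesis using y by auto
    next
      case False
      then have e: "ereal (win_end k \<sigma>) = gam (ai (k + 1))" using win_end_cases by blast
      then have "win_end k s \<le> win_end k \<sigma>" using win_end_le_ai[of k s] by (metis ereal_less_eq(3))
      then have "win_end k \<sigma> = z" using win_end_mono[OF \<sigma>s, of k] zpk by simp
      then show ?thesis using zmin[of y] y z(1) \<sigma>s by simp
    qed
  qed
  then have "k \<in> finite_idx" "sig k = \<sigma>" using finite_idxI[OF k1 k(1) \<sigma>] by auto
  then show ?thesis using jk \<sigma>s by blast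
qed

text \<open>The maximum with \<open>s\<close> accounts for a local minimum that the left end of the
  window has passed; the tracked point is then the left end.\<close>

lemma tracked_point_minimal:
  assumes j: "j = 0 \<or> j \<in> finite_idx \<and> sig j \<le> s"
    and last: "\<And>k. k \<in> finite_idx \<Longrightarrow> sig k \<le> s \<Longrightarrow> k \<le> j"
    and y: "s \<le> y" "y \<le> s + len"
  shows "F (max s (win_end j s)) \<le> F y"
proof -
  have jB: "j \<le> nB" using j finite_idxD(2) by auto
  have left: "F (max s (win_end j s)) \<le> F y" if "s \<le> y" "y \<le> max s (win_end j s)" for y
  proof (cases "s \<le> win_end j s")
    case True
    have "j = 0 \<or> (\<exists>\<sigma>\<le>s. jump j \<sigma>)" using j finite_idxD(3) by blast
    then show ?thesis using minimal_to_the_left[OF jB, of s y] that True by (simp add: max_def)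
  next
    case False
    then have "y = s" using that by (simp add: max_def)
    then show ?thesis using False by (simp add: max_def)
  qed
  show ?thesis
  proof (rule ccontr)
    assume n: "\<not> ?thesis"
    then have "max s (win_end j s) < y" using left[OF y(1)] by (meson not_less)
    then obtain k where "k \<in> finite_idx" "j < k" "sig k \<le> s"
      using later_jump_if_beaten[OF jB left _ y(2)] n by auto
    then show False using last[of k] by simp
  qed
qed

text \<open>Let \<open>c\<close> be the local minimum following the \<open>i\<close>-th peak. If run
  \<open>k\<close> jumped first, run \<open>i\<close> not having jumped yields a point before its
  peak with a value below \<open>F c\<close>, while the jump of \<open>k\<close> and the feasibility
  of \<open>i\<close> make \<open>F c\<close> a lower bound there.\<close>

lemma sig_mono:
  assumes "i \<in> finite_idx" "k \<in> finite_idx" "i < k"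
  shows "sig i \<le> sig k"
proof (rule ccontr)
  assume "\<not> sig i \<le> sig k"
  then have lt: "sig k < sig i" by simp
  note i = finite_idxD[OF assms(1)] and k = finite_idxD[OF assms(2)]
  have "bi i < ai (i + 1)" by (rule bi_less_ai[OF i(2)])
  moreover have "ai (i + 1) < bi (i + 1)"
    using k(2) assms(3) nB_le_nA by (intro ai_less_bi) auto
  moreover have "bi (i + 1) \<le> bi k"
    using bi_mono[of "i + 1" k] k(2) assms(3) by (cases "i + 1 = k") auto
  ultimately have ab: "bi i < ai (i + 1)" "ai (i + 1) < bi k" by auto
  have "ai (i + 1) \<le> M" using ab bi_le[of k] by simp
  then obtain c where c: "gam (ai (i + 1)) = ereal c"
    using gam_ai_neq_MInf[of i] by (cases "gam (ai (i + 1))") (auto simp: gam_def split: if_splits)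
  have "gam (bi i) < gam (ai (i + 1))" "gam (ai (i + 1)) < gam (bi k)"
    using gam_less ab ai_le bi_le by auto
  then have bc: "\<gamma> (b i) < c" "c < \<gamma> (b k)" using c i k by (auto simp: gam_bi)
  have jk: "\<gamma> (b k) - len \<le> sig k" "D k (sig k) \<le> 0" "sig k \<le> \<gamma> (b k)" using k(3) by (auto simp: jump_def)
  have ji: "sig i \<le> \<gamma> (b i)" "\<And>s. \<gamma> (b i) - len \<le> s \<Longrightarrow> s < sig i \<Longrightarrow> D i s > 0"
    using i(3) by (auto simp: jump_def)
  have pki: "win_end i s = c" if "sig k \<le> s" for s
  proof -
    have "ereal (win_end i s) = ereal c" unfolding ereal_win_end c using that jk bc by (auto simp: min_def)
    then show ?thesis by simp
  qed
  have "D i (sig k) > 0" using ji(2)[of "sig k"] jk bc lt by simp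
  then have 1: "win_min (sig k) (\<gamma> (b i)) < F c" by (simp add: D_def pki)
  have "gam (bi k) \<le> ereal (win_end k (sig k))" using k jk by (intro win_end_ge_bi) (auto simp: gam_bi)
  then have pkk: "\<gamma> (b k) \<le> win_end k (sig k)" using k by (simp add: gam_bi)
  have "F c \<le> F (win_end k (sig k))"
    using i(4) lt pki[of "sig i"] pkk bc win_end_le[of k "sig k"] unfolding feasible_def by auto
  also have "\<dots> \<le> win_min (sig k) (\<gamma> (b k))" using jk by (simp add: D_def)
  also have "\<dots> \<le> win_min (sig k) (\<gamma> (b i))"
    using lt ji(1) bc win_min_split[of "sig k" "\<gamma> (b i)" "\<gamma> (b k)"] by simp
  finally show False using 1 by simp
qed

section \<open>The pieces of the minimiser\<close>

lemma finite_finite_idx [simp]: "finite finite_idx"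
  by (auto simp: finite_idx_def)

lemma l_in: "1 \<le> q \<Longrightarrow> q \<le> Q \<Longrightarrow> l q \<in> finite_idx"
  using nth_mem[of "q - 1" "sorted_list_of_set finite_idx"] by (simp add: l_def Q_def)

lemma l_less: "1 \<le> q \<Longrightarrow> q < q' \<Longrightarrow> q' \<le> Q \<Longrightarrow> l q < l q'"
  using sorted_wrt_nth_less[OF strict_sorted_list_of_set, of "q - 1" "q' - 1" finite_idx]
  by (simp add: l_def Q_def)

lemma l_surj: "k \<in> finite_idx \<Longrightarrow> \<exists>q. 1 \<le> q \<and> q \<le> Q \<and> l q = k"
proof -
  assume "k \<in> finite_idx"
  then have "k \<in> set (sorted_list_of_set finite_idx)" by simp
  then obtain n where "n < Q" "sorted_list_of_set finite_idx ! n = k"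
    unfolding in_set_conv_nth by (auto simp: Q_def)
  then show ?thesis by (intro exI[of _ "n + 1"]) (auto simp: l_def)
qed

text \<open>From \<open>ai (nB + 1)\<close> on \<open>F\<close> is nondecreasing, so nothing to the
  right can be better; if there is no such minimum, the window is never cut off.\<close>

lemma last_feasible:
  assumes "1 \<le> nB"
  shows "nB \<in> finite_idx"
proof -
  obtain \<sigma> where \<sigma>: "jump nB \<sigma>" using jump_exists assms by blast
  have "feasible nB \<sigma>" unfolding feasible_def
  proof (intro allI impI)
    fix y assume y: "win_end nB \<sigma> \<le> y \<and> y \<le> \<sigma> + len"
    show "F (win_end nB \<sigma>) \<le> F y"
    proof (cases "win_end nB \<sigma> = \<sigma> + len")
      case False
      then have "ereal (win_end nB \<sigma>) = gam (ai (nB + 1))" using win_end_cases by blast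
      then show ?thesis using y by (intro F_increasing[of nB]) (auto simp: bi_def gam_top)
    qed (use y in auto)
  qed
  then show ?thesis using finite_idxI assms \<sigma> by blast
qed

lemma Q_le: "Q \<le> nB"
proof -
  have "finite_idx \<subseteq> {1..nB}" by (auto simp: finite_idx_def)
  then show ?thesis using card_mono[of "{1..nB}" finite_idx] by (simp add: Q_def)
qed

lemma Q_pos: "1 \<le> nB \<Longrightarrow> 1 \<le> Q"
  using last_feasible l_surj by fastforce

lemma l_Q: "l Q = nB"
proof (cases "nB = 0")
  case True
  then show ?thesis using Q_le by (simp add: l_def)
next
  case False
  then obtain q where q: "1 \<le> q" "q \<le> Q" "l q = nB" using last_feasible l_surj by (metis One_nat_def Suc_leI neq0_conv)
  have "l Q \<le> nB" using l_in[of Q] q finite_idxD(2) by simp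
  then show ?thesis using l_less[of q Q] q by (cases "q = Q") auto
qed

lemma l_less_nB: "q < Q \<Longrightarrow> l q < nB"
  using l_less[of q Q] l_Q l_in[of Q] finite_idxD(1)[of "l Q"] by (cases "q = 0") (auto simp: l_def)

lemma tstar_eq: "1 \<le> q \<Longrightarrow> q \<le> Q \<Longrightarrow> tstar q = ereal (sig (l q) - x\<^sub>1)"
  using finite_idxD(5)[OF l_in[of q]] by (simp add: tstar_def)

lemma tstar_mono:
  assumes "q \<le> q'" "q' \<le> Q"
  shows "tstar q \<le> tstar q'"
proof (cases "q = 0 \<or> q = q'")
  case False
  then have "sig (l q) \<le> sig (l q')"
    using assms l_less[of q q'] by (intro sig_mono l_in) auto
  then show ?thesis using False assms by (simp add: tstar_eq)
qed (auto simp: tstar_def)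

text \<open>The index \<open>q = 0\<close>, with \<open>tstar 0\<close> minus infinity, keeps the
  set nonempty. As \<open>tstar\<close> is monotone, this counts the finite jumps up to time
  \<open>t\<close>, coinciding ones included.\<close>

definition njumps :: "real \<Rightarrow> nat" where
  "njumps t = Max {q. q \<le> Q \<and> tstar q \<le> ereal t}"

lemma njumps: "njumps t \<le> Q" "tstar (njumps t) \<le> ereal t"
proof -
  have "finite {q. q \<le> Q \<and> tstar q \<le> ereal t}" by simp
  moreover have "0 \<in> {q. q \<le> Q \<and> tstar q \<le> ereal t}" by (simp add: tstar_def)
  ultimately have "njumps t \<in> {q. q \<le> Q \<and> tstar q \<le> ereal t}"
    unfolding njumps_def by (intro Max_in) auto
  then show "njumps t \<le> Q" "tstar (njumps t) \<le> ereal t" by auto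
qed

lemma le_njumps: "q \<le> Q \<Longrightarrow> tstar q \<le> ereal t \<longleftrightarrow> q \<le> njumps t"
proof
  assume "q \<le> Q" "tstar q \<le> ereal t"
  then show "q \<le> njumps t" unfolding njumps_def by (intro Max_ge) auto
next
  assume "q \<le> Q" "q \<le> njumps t"
  then show "tstar q \<le> ereal t" using tstar_mono[of q "njumps t"] njumps[of t] by (auto intro: order_trans)
qed

text \<open>A single closed form for all pieces: the local minimum clamped to the window, in the
  original coordinate.\<close>

definition track :: "nat \<Rightarrow> real \<Rightarrow> real" where
  "track k t = (if k < nA then max x\<^sub>1 (min x\<^sub>2 (\<gamma> (a (k + 1)) - t)) else x\<^sub>2)"

lemma track_win_end: "track k t + t = max (t + x\<^sub>1) (win_end k (t + x\<^sub>1))"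
proof (cases "k < nA")
  case True
  then have "gam (ai (k + 1)) = ereal (\<gamma> (a (k + 1)))" using a_range[of "k + 1"] by (simp add: ai_def gam_eq)
  then have "win_end k (t + x\<^sub>1) = min (t + x\<^sub>2) (\<gamma> (a (k + 1)))"
    using ereal_win_end[of k "t + x\<^sub>1"] by (simp add: len_def algebra_simps flip: ereal_min)
  then show ?thesis using True by (auto simp: track_def)
next
  case False
  then have "gam (ai (k + 1)) = \<infinity>" by (simp add: ai_def gam_top)
  then have "ereal (win_end k (t + x\<^sub>1)) = ereal (t + x\<^sub>2)"
    using ereal_win_end[of k "t + x\<^sub>1"] by (simp add: len_def min_def algebra_simps)
  then show ?thesis using False x12 by (simp add: track_def)
qed

lemma track_range: "x\<^sub>1 \<le> track k t" "track k t \<le> x\<^sub>2"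
  using x12 by (auto simp: track_def)

lemma track_minimal:
  assumes "x\<^sub>1 \<le> y" "y \<le> x\<^sub>2"
  shows "F (track (l (njumps t)) t + t) \<le> F (y + t)"
  unfolding track_win_end
proof (rule tracked_point_minimal)
  show "l (njumps t) = 0 \<or> l (njumps t) \<in> finite_idx \<and> sig (l (njumps t)) \<le> t + x\<^sub>1"
    using njumps[of t] l_in[of "njumps t"] tstar_eq[of "njumps t"]
    by (cases "njumps t = 0") (auto simp: l_def)
  fix k assume k: "k \<in> finite_idx" "sig k \<le> t + x\<^sub>1"
  then obtain q where q: "1 \<le> q" "q \<le> Q" "l q = k" using l_surj by blast
  then have "tstar q \<le> ereal t" using k tstar_eq[of q] by simp
  then have "q \<le> njumps t" using le_njumps q by blast
  then show "k \<le> l (njumps t)" using l_less[of q "njumps t"] q njumps(1)[of t] by (cases "q = njumps t") auto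
qed (use assms in \<open>auto simp: len_def\<close>)

lemma track_antimono: "s \<le> t \<Longrightarrow> track k t \<le> track k s"
  by (auto simp: track_def)

lemma track_cont: "continuous_on S (track k)"
  unfolding track_def by (cases "k < nA") (auto intro!: continuous_intros)

section \<open>Piecewise linearity and agreement with the stated pieces\<close>

definition kinks :: "nat \<Rightarrow> real set" where
  "kinks k = {\<gamma> (a (k + 1)) - x\<^sub>1, \<gamma> (a (k + 1)) - x\<^sub>2}"

lemma track_affine:
  assumes I: "is_interval I" "I \<inter> kinks k = {}"
  shows "\<exists>m c. \<forall>t\<in>I. track k t = m * t + c"
proof (cases "k < nA")
  case False
  then show ?thesis by (intro exI[of _ 0] exI[of _ "x\<^sub>2"]) (simp add: track_def)
next
  case True
  let ?g = "\<gamma> (a (k + 1))"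
  have side: "(\<forall>t\<in>I. t < w) \<or> (\<forall>t\<in>I. t > w)" if "w \<notin> I" for w
    using I(1) that unfolding is_interval_1 by (metis linorder_less_linear less_imp_le)
  have n: "?g - x\<^sub>1 \<notin> I" "?g - x\<^sub>2 \<notin> I" using I(2) by (auto simp: kinks_def)
  consider "\<forall>t\<in>I. t < ?g - x\<^sub>2" | "\<forall>t\<in>I. t > ?g - x\<^sub>1" | "\<forall>t\<in>I. ?g - x\<^sub>2 < t \<and> t < ?g - x\<^sub>1"
    using side[OF n(1)] side[OF n(2)] by blast
  then show ?thesis
  proof cases
    case 1
    have "track k t = 0 * t + x\<^sub>2" if "t \<in> I" for t
      using 1 that x12 True by (force simp: track_def)
    then show ?thesis by blast
  next
    case 2
    have "track k t = 0 * t + x\<^sub>1" if "t \<in> I" for t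
      using 2 that x12 True by (force simp: track_def)
    then show ?thesis by blast
  next
    case 3
    have "track k t = (- 1) * t + ?g" if "t \<in> I" for t
      using 3 that x12 True by (force simp: track_def)
    then show ?thesis by blast
  qed
qed

lemma regular_track:
  assumes "\<And>t. t \<in> S \<Longrightarrow> x t = track k t"
  shows "regular_piece S x"
  unfolding regular_piece_def
proof (intro conjI)
  show "continuous_on S x" using track_cont[of S k] assms by (simp cong: continuous_on_cong)
  show "antimono_on S x" using assms track_antimono by (auto simp: monotone_on_def)
  show "piecewise_linear_on S x" unfolding piecewise_linear_on_def
  proof (intro exI[of _ "kinks k"] conjI allI impI)
    show "finite (kinks k)" by (simp add: kinks_def)
    fix I assume I: "is_interval I \<and> I \<subseteq> S - kinks k"
    then have "\<exists>m c. \<forall>t\<in>I. track k t = m * t + c" by (intro track_affine) auto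
    then obtain m c where "\<forall>t\<in>I. track k t = m * t + c" by blast
    then have "\<forall>t\<in>I. x t = m * t + c" using I assms by (metis DiffD1 subsetD)
    then show "\<exists>m c. \<forall>t\<in>I. x t = m * t + c" by blast
  qed
qed

text \<open>The case distinctions in \<open>x_s\<close>, \<open>x_q\<close> and \<open>x_e\<close>
  only drop branches that do not meet the domain, so on their domains all three are instances of
  \<open>track\<close>.\<close>

lemma x_s_eq: "1 \<le> Q \<Longrightarrow> t \<in> dom_s \<Longrightarrow> x_s t = track 0 t"
  using Q_le nB_le_nA x12 tstar_eq[of 1] by (auto simp: x_s_def dom_s_def track_def)

lemma x_q_eq: "q < Q \<Longrightarrow> 1 \<le> q \<Longrightarrow> t \<in> dom_q q \<Longrightarrow> x_q q t = track (l q) t"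
  using l_less_nB[of q] nB_le_nA x12 tstar_eq[of q] tstar_eq[of "q + 1"]
  by (auto simp: x_q_def dom_q_def track_def \<Gamma>_def)

lemma x_e_eq: "t \<in> dom_e \<Longrightarrow> x_e t = track (l Q) t"
  using x12 tstar_eq[of Q]
  by (cases "Q = 0") (auto simp: x_e_def dom_e_def track_def \<Gamma>_def tstar_def)

lemma dom_s_iff: "1 \<le> Q \<Longrightarrow> t \<in> dom_s \<longleftrightarrow> njumps t = 0"
  using le_njumps[of 1 t] by (auto simp: dom_s_def not_le[symmetric])

lemma dom_q_iff: "q < Q \<Longrightarrow> t \<in> dom_q q \<longleftrightarrow> njumps t = q"
  using le_njumps[of q t] le_njumps[of "q + 1" t] by (auto simp: dom_q_def not_le[symmetric])

lemma dom_e_iff: "t \<in> dom_e \<longleftrightarrow> njumps t = Q"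
  using le_njumps[of Q t] njumps(1)[of t] by (auto simp: dom_e_def)

text \<open>The domains of the pieces are level sets of \<open>njumps\<close> and cover the line,
  which yields both existence and uniqueness of the composed function.\<close>

lemma composed_of_pieces_iff: "composed_of_pieces x \<longleftrightarrow> (\<forall>t. x t = track (l (njumps t)) t)"
proof
  assume c: "composed_of_pieces x"
  show "\<forall>t. x t = track (l (njumps t)) t"
  proof
    fix t
    consider "Q = 0" | "Q \<ge> 1" "njumps t = 0" | "1 \<le> njumps t" "njumps t < Q" | "Q \<ge> 1" "njumps t = Q"
      using njumps(1)[of t] by linarith
    then show "x t = track (l (njumps t)) t"
    proof cases
      case 1
      then have "x t = x_e t" using c by (simp add: composed_of_pieces_def)
      then show ?thesis using x_e_eq[of t] dom_e_iff[of t] njumps(1)[of t] 1 by simp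
    next
      case 2
      then have "x t = x_s t" using c dom_s_iff[of t] by (cases "Q = 1") (auto simp: composed_of_pieces_def)
      then show ?thesis using x_s_eq[of t] dom_s_iff[of t] 2 by (simp add: l_def)
    next
      case 3
      then have "x t = x_q (njumps t) t" using c dom_q_iff[of "njumps t" t] by (auto simp: composed_of_pieces_def)
      then show ?thesis using x_q_eq[of "njumps t" t] dom_q_iff[of "njumps t" t] 3 by simp
    next
      case 4
      then have "x t = x_e t" using c dom_e_iff[of t] by (cases "Q = 1") (auto simp: composed_of_pieces_def)
      then show ?thesis using x_e_eq[of t] dom_e_iff[of t] 4 by simp
    qed
  qed
next
  assume x: "\<forall>t. x t = track (l (njumps t)) t"
  have s: "x t = x_s t" if "1 \<le> Q" "t \<in> dom_s" for t
    using x x_s_eq[OF that] dom_s_iff[of t] that by (simp add: l_def)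
  have q: "x t = x_q q t" if "q \<in> {1..Q - 1}" "t \<in> dom_q q" for q t
  proof -
    have "1 \<le> q" "q < Q" using that by auto
    then show ?thesis using x x_q_eq[of q t] dom_q_iff[of q t] that by simp
  qed
  have e: "x t = x_e t" if "t \<in> dom_e" for t
    using x x_e_eq[OF that] dom_e_iff[of t] that by simp
  have e0: "t \<in> dom_e" if "Q = 0" for t using that njumps(1)[of t] dom_e_iff[of t] by simp
  show "composed_of_pieces x" unfolding composed_of_pieces_def
    using s q e e0 by simp
qed

lemma piecewise_linear_track: "piecewise_linear_on UNIV (\<lambda>t. track (l (njumps t)) t)"
  unfolding piecewise_linear_on_def
proof (intro exI[of _ "(\<lambda>q. real_of_ereal (tstar q)) ` {1..Q} \<union> (\<Union>q\<le>Q. kinks (l q))"] conjI allI impI)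
  let ?P = "(\<lambda>q. real_of_ereal (tstar q)) ` {1..Q} \<union> (\<Union>q\<le>Q. kinks (l q))"
  show "finite ?P" by (auto simp: kinks_def)
  fix I assume I: "is_interval I \<and> I \<subseteq> UNIV - ?P"
  show "\<exists>m c. \<forall>t\<in>I. track (l (njumps t)) t = m * t + c"
  proof (cases "I = {}")
    case False
    then obtain t\<^sub>0 where t0: "t\<^sub>0 \<in> I" by blast
    \<comment> \<open>An interval that avoids all finite jump times lies in one level set of
      \<open>njumps\<close>.\<close>
    have le: "njumps s \<le> njumps t" if st: "s \<in> I" "t \<in> I" for s t
    proof (rule ccontr)
      assume "\<not> njumps s \<le> njumps t"
      then have q: "1 \<le> njumps t + 1" "njumps t + 1 \<le> Q" "njumps t + 1 \<le> njumps s"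
        using njumps(1)[of s] by auto
      define r where "r = sig (l (njumps t + 1)) - x\<^sub>1"
      have r: "tstar (njumps t + 1) = ereal r" using tstar_eq[OF q(1,2)] by (simp add: r_def)
      have "r \<le> s" using le_njumps[OF q(2), of s] q(3) r by simp
      moreover have "t < r" using le_njumps[OF q(2), of t] r by simp
      moreover have "r \<in> ?P" using r q by (intro UnI1 image_eqI[of _ _ "njumps t + 1"]) auto
      moreover have "r \<in> I" if "r \<le> s" "t < r"
        using I st that unfolding is_interval_1 by (meson less_imp_le)
      ultimately show False using I by blast
    qed
    then have eq: "njumps t = njumps t\<^sub>0" if "t \<in> I" for t using that t0 by (simp add: antisym)
    have "I \<inter> kinks (l (njumps t\<^sub>0)) = {}" using I njumps(1)[of t\<^sub>0] by blast
    then have "\<exists>m c. \<forall>t\<in>I. track (l (njumps t\<^sub>0)) t = m * t + c" using I track_affine by blast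
    then show ?thesis using eq by simp
  qed simp
qed

end

theorem lemma1:
  fixes f g :: "real \<Rightarrow> real" and M :: nat and \<gamma> \<mu> :: "nat \<Rightarrow> real"
    and \<nu> x\<^sub>1 x\<^sub>2 :: real and Q nA nB :: nat and l :: "nat \<Rightarrow> nat" and tstar :: "nat \<Rightarrow> ereal"
  assumes "M \<ge> 1"
    and "\<forall>i\<in>{1..<M}. \<gamma> i < \<gamma> (i + 1)"
    and "\<forall>i<M. \<mu> (i + 1) \<noteq> \<mu> i"
    and "\<mu> 0 = 0"
    and "continuous_on UNIV f" and "mono f"
    and "\<forall>x\<le>\<gamma> 1. f x = 0"
    and "\<forall>i\<le>M. \<exists>c. \<forall>x. pl_window.gam M \<gamma> i \<le> ereal x \<and> ereal x < pl_window.gam M \<gamma> (i + 1)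
            \<longrightarrow> f x = \<mu> i * x + c"
    and "x\<^sub>1 < x\<^sub>2" and "\<nu> > 0"
    and "\<forall>x. g x = (if x\<^sub>1 \<le> x \<and> x < x\<^sub>2 then - \<nu> * (x - x\<^sub>2) else 0)"
    and "nA = card (pl_window.setA M \<mu> \<nu>)"
    and "nB = card (pl_window.setB M \<mu> \<nu>)"
    and "Q = pl_window.Q M \<gamma> \<mu> \<nu> x\<^sub>1 x\<^sub>2"
    and "l = pl_window.l M \<gamma> \<mu> \<nu> x\<^sub>1 x\<^sub>2"
    and "tstar = pl_window.tstar M \<gamma> \<mu> \<nu> x\<^sub>1 x\<^sub>2"
  shows "(nB \<ge> 1 \<longrightarrow> 1 \<le> Q \<and> Q \<le> nB)
    \<and> (nB = 0 \<longrightarrow> Q = 0)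
    \<and> l Q = nB
    \<and> (nA > nB \<longrightarrow> l Q + 1 = nA)
    \<and> (Q \<ge> 1 \<longrightarrow> pl_window.regular_piece (pl_window.dom_s M \<gamma> \<mu> \<nu> x\<^sub>1 x\<^sub>2)
                                        (pl_window.x_s M \<gamma> \<mu> \<nu> x\<^sub>1 x\<^sub>2))
    \<and> (\<forall>q\<in>{1..<Q}. pl_window.regular_piece (pl_window.dom_q M \<gamma> \<mu> \<nu> x\<^sub>1 x\<^sub>2 q)
                                           (pl_window.x_q M \<gamma> \<mu> \<nu> x\<^sub>1 x\<^sub>2 q))
    \<and> pl_window.regular_piece (pl_window.dom_e M \<gamma> \<mu> \<nu> x\<^sub>1 x\<^sub>2)
                              (pl_window.x_e M \<gamma> \<mu> \<nu> x\<^sub>1 x\<^sub>2)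
    \<and> (\<exists>!x. pl_window.composed_of_pieces M \<gamma> \<mu> \<nu> x\<^sub>1 x\<^sub>2 x)
    \<and> (\<forall>x. pl_window.composed_of_pieces M \<gamma> \<mu> \<nu> x\<^sub>1 x\<^sub>2 x \<longrightarrow>
          (\<forall>t. is_arg_min (\<lambda>y. f (y + t) + g y) (\<lambda>y. x\<^sub>1 \<le> y \<and> y \<le> x\<^sub>2) (x t))
        \<and> piecewise_linear_on UNIV x
        \<and> (\<forall>s t. s \<le> t \<and> \<not> (\<exists>q\<in>{1..Q}. ereal s < tstar q \<and> tstar q \<le> ereal t)
               \<longrightarrow> x t \<le> x s))"
proof -
  interpret W: window_problem M \<gamma> \<mu> \<nu> x\<^sub>1 x\<^sub>2 f
    using assms by unfold_locales auto
  note defs = assms(12-16)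
  \<comment> \<open>At \<open>y = x\<^sub>2\<close> the linear formula also gives 0, so it describes
    \<open>g\<close> on the whole closed window, and the objective differs from \<open>F\<close> by
    a constant.\<close>
  have g: "f (y + t) + g y = W.F (y + t) + \<nu> * t + \<nu> * x\<^sub>2" if "x\<^sub>1 \<le> y" "y \<le> x\<^sub>2" for y t
    using assms(11) that by (auto simp: W.F_def algebra_simps)
  have x: "x = (\<lambda>t. W.track (W.l (W.njumps t)) t)" if "W.composed_of_pieces x" for x
    using that by (auto simp: W.composed_of_pieces_iff)
  have arg_min: "is_arg_min (\<lambda>y. f (y + t) + g y) (\<lambda>y. x\<^sub>1 \<le> y \<and> y \<le> x\<^sub>2) (x t)"
    if "W.composed_of_pieces x" for x t
    unfolding x[OF that] is_arg_min_def
    using W.track_range W.track_minimal[of _ t] g by (auto simp: not_less)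
  have anti: "x t \<le> x s" if c: "W.composed_of_pieces x" and st: "s \<le> t"
    and no: "\<not> (\<exists>q\<in>{1..Q}. ereal s < tstar q \<and> tstar q \<le> ereal t)" for x s t
  proof -
    \<comment> \<open>Without a jump after \<open>s\<close> and up to \<open>t\<close>, both times
      belong to the same piece, which is nonincreasing.\<close>
    have "W.njumps s = W.njumps t"
    proof (rule antisym)
      have "W.tstar (W.njumps s) \<le> ereal t" using W.njumps(2)[of s] st by (meson ereal_less_eq(3) order_trans)
      then show "W.njumps s \<le> W.njumps t" using W.le_njumps W.njumps(1) by blast
      show "W.njumps t \<le> W.njumps s"
      proof (cases "W.njumps t = 0")
        case False
        then have "W.njumps t \<in> {1..Q}" using W.njumps(1)[of t] defs(3) by simp
        then have "tstar (W.njumps t) \<le> ereal s" using no W.njumps(2)[of t] defs(5) not_less by blast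
        then show ?thesis using W.le_njumps W.njumps(1) defs(5) by blast
      qed simp
    qed
    then show ?thesis using W.track_antimono[OF st] by (simp add: x[OF c])
  qed
  show ?thesis
  proof (intro conjI allI impI ballI)
    show "1 \<le> Q" if "nB \<ge> 1" using that W.Q_pos by (simp add: defs)
    show "Q \<le> nB" using W.Q_le by (simp add: defs)
    show "Q = 0" if "nB = 0" using that W.Q_le by (simp add: defs)
    show "l Q = nB" using W.l_Q by (simp add: defs)
    show "l Q + 1 = nA" if "nA > nB" using that W.l_Q W.nA_le by (simp add: defs)
    show "W.regular_piece W.dom_s W.x_s" if "Q \<ge> 1"
      using that W.x_s_eq by (intro W.regular_track[where k = 0]) (simp add: defs)
    show "W.regular_piece (W.dom_q q) (W.x_q q)" if "q \<in> {1..<Q}" for q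
      using that W.x_q_eq by (intro W.regular_track[where k = "W.l q"]) (simp add: defs)
    show "W.regular_piece W.dom_e W.x_e" using W.x_e_eq by (intro W.regular_track)
    show "\<exists>!x. W.composed_of_pieces x"
      by (rule ex1I[of _ "\<lambda>t. W.track (W.l (W.njumps t)) t"]) (auto simp: W.composed_of_pieces_iff)
    fix x assume c: "W.composed_of_pieces x"
    show "piecewise_linear_on UNIV x" using W.piecewise_linear_track by (simp add: x[OF c])
    show "is_arg_min (\<lambda>y. f (y + t) + g y) (\<lambda>y. x\<^sub>1 \<le> y \<and> y \<le> x\<^sub>2) (x t)" for t
      using arg_min[OF c] .
    show "x t \<le> x s" if "s \<le> t \<and> \<not> (\<exists>q\<in>{1..Q}. ereal s < tstar q \<and> tstar q \<le> ereal t)" for s t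
      using anti[OF c] that by blast
  qed
qed

end
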